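(* Let $d\ge 2$ and $m,n\ge 1$ be integers with $m+n=d$, let $\omega$ be an $(m,n)$-weight vector, let $k\in\{1,\dots,d-1\}$, and let $\Lambda\subset\mathbb{R}^d$ be a unimodular lattice. Suppose that for every $k$-dimensional linear subspace $W\subset\mathbb{R}^d$ spanned by vectors of $\Lambda$, the largest eigenvalue in the decomposition of $v_W$ into eigenvectors of $a^{\omega}_1$ in $\bigwedge^k\mathbb{R}^d$ is strictly greater than $1$. Then $\boldsymbol{L}^{\omega}(\Lambda,\cdot)$ is connected at $k$.
   Context: A vector $\omega=(\omega_1,\dots,\omega_d)\in\mathbb{R}^d$ is an $(m,n)$-weight vector if $\omega_1\ge\cdots\ge\omega_m>0$, $\omega_{m+1}\ge\cdots\ge\omega_d>0$ and $\sum_{i=1}^m\omega_i=\sum_{j=m+1}^d\omega_j=1$. For $t\in\mathbb{R}$ put $a^{\omega}_t=\mathrm{diag}(e^{\omega_1 t},\dots,e^{\omega_m t},e^{-\omega_{m+1}t},\dots,e^{-\omega_d t})\in \mathrm{SL}_d(\mathbb{R})$. A unimodular lattice is a lattice in $\mathbb{R}^d$ of covolume $1$. Let $\mathcal{C}$ be the closed unit cube of $\mathbb{R}^d$ centered at $0$ (its side length is immaterial below: rescaling $\mathcal{C}$ adds the same constant to all $L_i^\omega$). For a unimodular lattice $\Lambda$, $t\ge 0$ and $1\le i\le d$, $\lambda_i(a^{\omega}_t\Lambda)$ is the least $\lambda>0$ such that $\lambda\mathcal{C}$ contains $i$ linearly independent vectors of $a^{\omega}_t\Lambda$. Set $L^{\omega}_i(\Lambda,t)=\log\lambda_i(a^{\omega}_t\Lambda)$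 and $\boldsymbol{L}^{\omega}(\Lambda,t)=(L^{\omega}_1(\Lambda,t),\dots,L^{\omega}_d(\Lambda,t))$. For $k\in\{1,\dots,d-1\}$, $\boldsymbol{L}^{\omega}(\Lambda,\cdot)$ is connected at $k$ if the set $\{t\ge 0: L^{\omega}_k(\Lambda,t)=L^{\omega}_{k+1}(\Lambda,t)\}$ is unbounded above. For a $k$-dimensional subspace $W$ with basis $w_1,\dots,w_k$, $v_W=w_1\wedge\cdots\wedge w_k\in\bigwedge^k\mathbb{R}^d$ (well defined up to a nonzero scalar). The group $\mathrm{SL}_d(\mathbb{R})$ acts on $\bigwedge^k\mathbb{R}^d$ by $g(v_1\wedge\cdots\wedge v_k)=gv_1\wedge\cdots\wedge gv_k$. Since $a^{\omega}_1$ acts diagonalizably on $\bigwedge^k\mathbb{R}^d$, every vector $v$ is uniquely a sum of its components in the distinct eigenspaces of $a_1^\omega$; "the largest eigenvalue in the decomposition of $v$ into eigenvectors of $a^\omega_1$" is the largest eigenvalue of $a_1^\omega$ whose eigenspace component of $v$ is nonzero. *)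

theory Defs
  imports "HOL-Analysis.Analysis"
begin

text \<open>
  The dimension is \<open>d = CARD('d)\<close>. The linear order on the index type \<open>'d\<close> makes sense of
  ``the first \<open>m\<close> coordinates''; \<open>idx\<close> is the resulting numbering of the coordinates by
  \<open>1, \<dots>, d\<close>.
\<close>

type_synonym 'd rvec = "(real, 'd) vec"
type_synonym 'd rmat = "((real, 'd) vec, 'd) vec"
type_synonym 'd ext = "(real, 'd set) vec"

definition idx :: "'d::{finite,linorder} \<Rightarrow> nat" where
  "idx i = card {..i}"

definition weight_vector :: "nat \<Rightarrow> nat \<Rightarrow> 'd::{finite,linorder} rvec \<Rightarrow> bool" where
  "weight_vector m n \<omega> \<longleftrightarrow>
     m + n = CARD('d) \<and>
     (\<forall>i. \<omega> $ i > 0) \<and>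
     (\<forall>i j. i \<le> j \<and> idx j \<le> m \<longrightarrow> \<omega> $ j \<le> \<omega> $ i) \<and>
     (\<forall>i j. m < idx i \<and> i \<le> j \<longrightarrow> \<omega> $ j \<le> \<omega> $ i) \<and>
     (\<Sum>i | idx i \<le> m. \<omega> $ i) = 1 \<and>
     (\<Sum>i | m < idx i. \<omega> $ i) = 1"

definition diag_flow :: "nat \<Rightarrow> 'd::{finite,linorder} rvec \<Rightarrow> real \<Rightarrow> 'd rmat" where
  "diag_flow m \<omega> t =
     (\<chi> i j. if i = j then exp ((if idx i \<le> m then \<omega> $ i else - \<omega> $ i) * t) else 0)"

text \<open>A lattice is the \<open>\<int>\<close>-span of the columns of an invertible matrix \<open>B\<close>, and its covolume
  is \<open>\<bar>det B\<bar>\<close>.\<close>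

definition unimodular_lattice :: "'d::finite rvec set \<Rightarrow> bool" where
  "unimodular_lattice \<Lambda> \<longleftrightarrow>
     (\<exists>B :: 'd rmat. \<bar>det B\<bar> = 1 \<and> \<Lambda> = (\<lambda>z. B *v z) ` {z. \<forall>i. z $ i \<in> \<int>})"

definition unit_cube :: "'d::finite rvec set" where
  "unit_cube = {x. \<forall>i. \<bar>x $ i\<bar> \<le> 1 / 2}"

definition succ_min :: "nat \<Rightarrow> 'd::finite rvec set \<Rightarrow> real" where
  "succ_min i \<Lambda> =
     (LEAST r. r > 0 \<and> (\<exists>S \<subseteq> \<Lambda> \<inter> (*\<^sub>R) r ` unit_cube. independent S \<and> card S = i))"

definition log_min ::
  "nat \<Rightarrow> 'd::{finite,linorder} rvec \<Rightarrow> 'd rvec set \<Rightarrow> nat \<Rightarrow> real \<Rightarrow> real" where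
  "log_min m \<omega> \<Lambda> i t = ln (succ_min i ((\<lambda>x. diag_flow m \<omega> t *v x) ` \<Lambda>))"

definition connected_at ::
  "nat \<Rightarrow> 'd::{finite,linorder} rvec \<Rightarrow> 'd rvec set \<Rightarrow> nat \<Rightarrow> bool" where
  "connected_at m \<omega> \<Lambda> k \<longleftrightarrow>
     \<not> bdd_above {t. t \<ge> 0 \<and> log_min m \<omega> \<Lambda> k t = log_min m \<omega> \<Lambda> (k + 1) t}"

text \<open>
  The exterior algebra of \<open>\<real>\<^sup>d\<close> is \<open>'d ext\<close>: the coordinate at \<open>I = {i\<^sub>1 < \<dots> < i\<^sub>k}\<close> is
  the coefficient of \<open>e\<^sub>I = e\<^bsub>i\<^sub>1\<^esub> \<and> \<dots> \<and> e\<^bsub>i\<^sub>k\<^esub>\<close>, and the \<open>k\<close>-th exterior power is the span of the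
  \<open>e\<^sub>I\<close> with \<open>card I = k\<close>. The coefficients of \<open>v\<^sub>1 \<and> \<dots> \<and> v\<^sub>k\<close> are the \<open>k \<times> k\<close> minors of the
  matrix with columns \<open>v\<^sub>1, \<dots>, v\<^sub>k\<close>, written out by the Leibniz formula.
\<close>

definition ext_power :: "nat \<Rightarrow> 'd::finite ext set" where
  "ext_power k = {x. \<forall>I. card I \<noteq> k \<longrightarrow> x $ I = 0}"

definition wedge :: "'d::{finite,linorder} rvec list \<Rightarrow> 'd ext" where
  "wedge vs = (\<chi> I.
     if card I = length vs
     then \<Sum>p | p permutes {..<length vs}.
            of_int (sign p) * (\<Prod>j<length vs. (vs ! j) $ (sorted_list_of_set I ! p j))
     else 0)"

text \<open>The action of a matrix, by linear extension of
  \<open>g (e\<^bsub>i\<^sub>1\<^esub> \<and> \<dots> \<and> e\<^bsub>i\<^sub>k\<^esub>) = g e\<^bsub>i\<^sub>1\<^esub> \<and> \<dots> \<and> g e\<^bsub>i\<^sub>k\<^esub>\<close>. Lemma \<open>ext_act_wedge\<close> below shows that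
  \<open>g (v\<^sub>1 \<and> \<dots> \<and> v\<^sub>k) = g v\<^sub>1 \<and> \<dots> \<and> g v\<^sub>k\<close> for all vectors.\<close>

definition ext_act :: "'d::{finite,linorder} rmat \<Rightarrow> 'd ext \<Rightarrow> 'd ext" where
  "ext_act g x =
     (\<Sum>I\<in>UNIV. (x $ I) *\<^sub>R wedge (map (\<lambda>i. g *v axis i 1) (sorted_list_of_set I)))"

lemma wedge_map_upt:
  "wedge (map v [0..<k]) $ I =
     (if card I = k
      then \<Sum>p | p permutes {..<k}. of_int (sign p) * (\<Prod>j<k. v j $ (sorted_list_of_set I ! p j))
      else 0)"
  by (auto simp: wedge_def intro!: sum.cong prod.cong)

lemma wedge_permute:
  assumes q: "q permutes {..<k}"
  shows "wedge (map (\<lambda>j. v (q j)) [0..<k]) = of_int (sign q) *\<^sub>R wedge (map v [0..<k])"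
proof -
  have "(\<Sum>p | p permutes {..<k}. of_int (sign p) * (\<Prod>j<k. v (q j) $ (e (p j)))) =
        of_int (sign q) * (\<Sum>p | p permutes {..<k}. of_int (sign p) * (\<Prod>j<k. v j $ (e (p j))))"
    (is "?l = _ * ?r") for e :: "nat \<Rightarrow> 'a"
  proof -
    have "?l = (\<Sum>p | p permutes {..<k}. of_int (sign (p \<circ> q)) * (\<Prod>j<k. v (q j) $ (e (p (q j)))))"
      using sum_permutations_compose_right[OF q,
          of "\<lambda>p. of_int (sign p) * (\<Prod>j<k. v (q j) $ (e (p j)))"] by simp
    also have "\<dots> = (\<Sum>p | p permutes {..<k}. of_int (sign q) * (of_int (sign p) * (\<Prod>j<k. v j $ (e (p j)))))"
    proof (intro sum.cong refl)
      fix p assume "p \<in> {p. p permutes {..<k}}"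
      then have p: "p permutes {..<k}" by simp
      have "sign (p \<circ> q) = sign p * sign q"
        using p q by (intro sign_compose) (auto simp: permutation_permutes)
      moreover have "(\<Prod>j<k. v (q j) $ (e (p (q j)))) = (\<Prod>j<k. v j $ (e (p j)))"
        using prod.permute[OF q, of "\<lambda>j. v j $ (e (p j))"] by (simp add: o_def)
      ultimately show "of_int (sign (p \<circ> q)) * (\<Prod>j<k. v (q j) $ (e (p (q j)))) =
          of_int (sign q) * (of_int (sign p) * (\<Prod>j<k. v j $ (e (p j))))"
        by simp
    qed
    finally show ?thesis by (simp add: sum_distrib_left)
  qed
  then show ?thesis
    by (simp add: vec_eq_iff wedge_map_upt)
qed

lemma wedge_repeat:
  assumes "i < k" "j < k" "i \<noteq> j" "v i = v j"
  shows "wedge (map v [0..<k]) = 0"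
proof -
  define q where "q = Transposition.transpose i j"
  have q: "q permutes {..<k}"
    using assms by (auto simp: q_def intro: permutes_swap_id)
  have v: "v (q l) = v l" for l
    using assms by (auto simp: q_def Transposition.transpose_def)
  have "wedge (map v [0..<k]) = of_int (sign q) *\<^sub>R wedge (map v [0..<k])" (is "?w = _")
    using wedge_permute[OF q, of v] unfolding v .
  also have "\<dots> = - ?w"
    using assms by (simp add: q_def sign_swap_id)
  finally have "?w + ?w = 0"
    by (rule iffD1[OF eq_neg_iff_add_eq_0])
  then have "2 *\<^sub>R ?w = 0"
    by (simp only: scaleR_2)
  then show ?thesis by simp
qed

lemma wedge_sum_expand:
  fixes u :: "'b \<Rightarrow> 'd::{finite,linorder} rvec"
  assumes "finite B"
  shows "wedge (map (\<lambda>j. \<Sum>b\<in>B. A j b *\<^sub>R u b) [0..<k]) =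
    (\<Sum>f\<in>PiE {..<k} (\<lambda>_. B). (\<Prod>j<k. A j (f j)) *\<^sub>R wedge (map (\<lambda>j. u (f j)) [0..<k]))"
proof -
  let ?F = "PiE {..<k} (\<lambda>_. B)"
  have "(\<Sum>p | p permutes {..<k}. of_int (sign p) * (\<Prod>j<k. (\<Sum>b\<in>B. A j b *\<^sub>R u b) $ (e (p j)))) =
      (\<Sum>f\<in>?F. (\<Prod>j<k. A j (f j)) *
         (\<Sum>p | p permutes {..<k}. of_int (sign p) * (\<Prod>j<k. u (f j) $ (e (p j)))))"
    (is "?l = ?r") for e :: "nat \<Rightarrow> 'd"
  proof -
    have "?l = (\<Sum>p | p permutes {..<k}. of_int (sign p) *
        (\<Sum>f\<in>?F. \<Prod>j<k. A j (f j) * u (f j) $ (e (p j))))"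
      using assms by (simp add: prod_sum_PiE)
    also have "\<dots> = (\<Sum>p | p permutes {..<k}. \<Sum>f\<in>?F. (\<Prod>j<k. A j (f j)) *
         (of_int (sign p) * (\<Prod>j<k. u (f j) $ (e (p j)))))"
      by (simp add: sum_distrib_left prod.distrib algebra_simps)
    also have "\<dots> = (\<Sum>f\<in>?F. \<Sum>p | p permutes {..<k}. (\<Prod>j<k. A j (f j)) *
         (of_int (sign p) * (\<Prod>j<k. u (f j) $ (e (p j)))))"
      by (rule sum.swap)
    finally show ?thesis by (simp add: sum_distrib_left)
  qed
  then show ?thesis
    by (simp add: vec_eq_iff wedge_map_upt)
qed

lemma permutes_bij_betw_enumerations:
  assumes "distinct xs"
  shows "bij_betw (\<lambda>q. restrict (\<lambda>j. xs ! q j) {..<length xs})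
     {q. q permutes {..<length xs}} {f \<in> PiE {..<length xs} (\<lambda>_. set xs). f ` {..<length xs} = set xs}"
    (is "bij_betw ?h ?P ?E")
proof (rule bij_betw_imageI)
  let ?k = "length xs"
  have xs: "bij_betw ((!) xs) {..<?k} (set xs)"
    using assms by (intro bij_betw_nth) auto
  show "inj_on ?h ?P"
  proof (rule inj_onI, clarsimp)
    fix p q assume p: "p permutes {..<?k}" and q: "q permutes {..<?k}" and eq: "?h p = ?h q"
    show "p = q"
    proof
      fix j show "p j = q j"
      proof (cases "j < ?k")
        case True
        then have "xs ! p j = xs ! q j"
          using fun_cong[OF eq, of j] by simp
        moreover have "p j < ?k" "q j < ?k"
          using True permutes_in_image[OF p, of j] permutes_in_image[OF q, of j] by auto
        ultimately show ?thesis using assms by (simp add: nth_eq_iff_index_eq)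
      next
        case False
        then show ?thesis using p q by (simp add: permutes_not_in)
      qed
    qed
  qed
  show "?h ` ?P = ?E"
  proof (intro equalityI subsetI)
    fix f assume "f \<in> ?h ` ?P"
    then obtain q where q: "q permutes {..<?k}" and f: "f = ?h q" by auto
    have "f ` {..<?k} = (!) xs ` q ` {..<?k}"
      unfolding f image_image by (intro image_cong) auto
    also have "\<dots> = set xs"
      using xs by (simp add: permutes_image[OF q] bij_betw_def)
    finally have "f ` {..<?k} = set xs" .
    then show "f \<in> ?E" by (auto simp: f)
  next
    fix f assume f: "f \<in> ?E"
    have "bij_betw f {..<?k} (set xs)"
      using f assms by (auto simp: bij_betw_def distinct_card intro!: eq_card_imp_inj_on)
    then have "bij_betw (inv_into {..<?k} ((!) xs) \<circ> f) {..<?k} {..<?k}"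
      using bij_betw_inv_into[OF xs] bij_betw_trans by blast
    then have g: "bij_betw (\<lambda>j. if j \<in> {..<?k} then inv_into {..<?k} ((!) xs) (f j) else j) {..<?k} {..<?k}"
      (is "bij_betw ?g _ _")
      by (rule iffD1[OF bij_betw_cong, rotated]) auto
    have "?g permutes {..<?k}"
      by (rule bij_imp_permutes[OF g]) auto
    moreover have "f = ?h ?g"
    proof
      fix j show "f j = ?h ?g j"
      proof (cases "j < ?k")
        case True
        then have "f j \<in> (!) xs ` {..<?k}" using f xs by (auto simp: bij_betw_def)
        then show ?thesis using True by (simp add: f_inv_into_f)
      next
        case False
        then show ?thesis using f by (auto simp: PiE_def extensional_def)
      qed
    qed
    ultimately show "f \<in> ?h ` ?P"
      by (intro image_eqI[of _ _ ?g] CollectI)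
  qed
qed

lemma wedge_sum_enumerations:
  assumes "distinct xs"
  shows "(\<Sum>f | f \<in> PiE {..<length xs} (\<lambda>_. set xs) \<and> f ` {..<length xs} = set xs.
            (\<Prod>j<length xs. A j (f j)) *\<^sub>R wedge (map (\<lambda>j. u (f j)) [0..<length xs])) =
         (\<Sum>q | q permutes {..<length xs}. of_int (sign q) * (\<Prod>j<length xs. A j (xs ! q j)))
           *\<^sub>R wedge (map u xs)"
    (is "?l = ?r")
proof -
  let ?k = "length xs"
  have "?l = (\<Sum>q | q permutes {..<?k}. (\<Prod>j<?k. A j (xs ! q j)) *\<^sub>R
      wedge (map (\<lambda>j. u (xs ! q j)) [0..<?k]))"
    by (subst sum.reindex_bij_betw[OF permutes_bij_betw_enumerations[OF assms], symmetric])
       (auto intro!: sum.cong prod.cong arg_cong2[where f = scaleR] arg_cong[where f = wedge])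
  also have "\<dots> = (\<Sum>q | q permutes {..<?k}. (of_int (sign q) * (\<Prod>j<?k. A j (xs ! q j))) *\<^sub>R wedge (map u xs))"
  proof (intro sum.cong refl)
    fix q assume "q \<in> {q. q permutes {..<?k}}"
    then have q: "q permutes {..<?k}" by simp
    have "map (\<lambda>j. u (xs ! j)) [0..<?k] = map u xs"
      by (rule nth_equalityI) auto
    then show "(\<Prod>j<?k. A j (xs ! q j)) *\<^sub>R wedge (map (\<lambda>j. u (xs ! q j)) [0..<?k]) =
        (of_int (sign q) * (\<Prod>j<?k. A j (xs ! q j))) *\<^sub>R wedge (map u xs)"
      using wedge_permute[OF q, of "\<lambda>j. u (xs ! j)"] by simp
  qed
  finally show ?thesis by (simp add: scaleR_sum_left)
qed

lemma wedge_sum_nonenumeration: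
  assumes "f \<in> PiE {..<k} (\<lambda>_. B)" "card (f ` {..<k}) \<noteq> k"
  shows "wedge (map (\<lambda>j. u (f j)) [0..<k]) = 0"
proof -
  have "\<not> inj_on f {..<k}" using assms(2) card_image by fastforce
  then obtain i j where "i < k" "j < k" "i \<noteq> j" "f i = f j"
    by (auto simp: inj_on_def)
  then show ?thesis by (intro wedge_repeat[of i k j]) auto
qed

lemma ext_act_wedge: "ext_act g (wedge vs) = wedge (map (\<lambda>v. g *v v) vs)"
proof -
  let ?k = "length vs"
  let ?u = "\<lambda>i. g *v axis i 1"
  let ?F = "PiE {..<?k} (\<lambda>_. UNIV :: 'a set)"
  let ?T = "\<lambda>f. (\<Prod>j<?k. vs ! j $ f j) *\<^sub>R wedge (map (\<lambda>j. ?u (f j)) [0..<?k])"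
  have exp: "g *v v = (\<Sum>i\<in>UNIV. (v $ i) *\<^sub>R ?u i)" for v :: "'a rvec"
  proof -
    have "v = (\<Sum>i\<in>UNIV. (v $ i) *\<^sub>R axis i 1)"
      using basis_expansion[of v] by (simp add: scalar_mult_eq_scaleR)
    then have "g *v v = g *v (\<Sum>i\<in>UNIV. (v $ i) *\<^sub>R axis i 1)"
      by (rule arg_cong)
    also have "\<dots> = (\<Sum>i\<in>UNIV. (v $ i) *\<^sub>R ?u i)"
      by (simp add: linear_sum[OF matrix_vector_mul_linear] matrix_vector_mult_scaleR)
    finally show ?thesis .
  qed
  have "map (\<lambda>v. g *v v) vs = map (\<lambda>j. g *v (vs ! j)) [0..<?k]"
    by (rule nth_equalityI) auto
  also have "\<dots> = map (\<lambda>j. \<Sum>i\<in>UNIV. (vs ! j $ i) *\<^sub>R ?u i) [0..<?k]"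
    by (intro map_cong refl exp)
  finally have "wedge (map (\<lambda>v. g *v v) vs) = wedge \<dots>"
    by (rule arg_cong)
  also have "\<dots> = (\<Sum>f\<in>?F. ?T f)"
    by (rule wedge_sum_expand) simp
  also have "\<dots> = (\<Sum>I\<in>UNIV. \<Sum>f | f \<in> ?F \<and> f ` {..<?k} = I. ?T f)"
    by (rule sum.group[symmetric]) (auto intro: finite_PiE)
  also have "\<dots> = (\<Sum>I\<in>UNIV. (wedge vs $ I) *\<^sub>R wedge (map ?u (sorted_list_of_set I)))"
  proof (intro sum.cong refl)
    fix I :: "'a set"
    let ?xs = "sorted_list_of_set I"
    show "(\<Sum>f | f \<in> ?F \<and> f ` {..<?k} = I. ?T f) = (wedge vs $ I) *\<^sub>R wedge (map ?u ?xs)"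
    proof (cases "card I = ?k")
      case True
      have "{f. f \<in> ?F \<and> f ` {..<?k} = I} = {f. f \<in> PiE {..<?k} (\<lambda>_. I) \<and> f ` {..<?k} = I}"
        by (auto simp: PiE_def)
      moreover have "wedge vs $ I =
          (\<Sum>q | q permutes {..<?k}. of_int (sign q) * (\<Prod>j<?k. vs ! j $ (?xs ! q j)))"
        using True by (simp add: wedge_def)
      ultimately show ?thesis
        using wedge_sum_enumerations[of ?xs "\<lambda>j b. vs ! j $ b" ?u] True by simp
    next
      case False
      then have "wedge vs $ I = 0"
        by (simp add: wedge_def)
      moreover have "(\<Sum>f | f \<in> ?F \<and> f ` {..<?k} = I. ?T f) = 0"
      proof (intro sum.neutral ballI)
        fix f assume f: "f \<in> {f. f \<in> ?F \<and> f ` {..<?k} = I}"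
        then have "wedge (map (\<lambda>j. ?u (f j)) [0..<?k]) = 0"
          using False by (intro wedge_sum_nonenumeration[of f ?k _ ?u]) auto
        then show "?T f = 0" by (rule ssubst) simp
      qed
      ultimately show ?thesis by simp
    qed
  qed
  finally show ?thesis by (simp add: ext_act_def)
qed

lemma wedge_change_basis:
  assumes "distinct xs" "set ys \<subseteq> span (set xs)" "length ys = length xs"
  shows "\<exists>r. wedge ys = r *\<^sub>R wedge xs"
proof -
  let ?k = "length xs"
  have "\<exists>a. y = (\<Sum>x\<in>set xs. a x *\<^sub>R x)" if "y \<in> set ys" for y
    using that assms(2) by (auto simp: span_finite)
  then obtain a where a: "\<And>y. y \<in> set ys \<Longrightarrow> y = (\<Sum>x\<in>set xs. a y x *\<^sub>R x)" by metis
  let ?T = "\<lambda>f. (\<Prod>j<?k. a (ys ! j) (f j)) *\<^sub>R wedge (map (\<lambda>j. f j) [0..<?k])"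
  let ?F = "PiE {..<?k} (\<lambda>_. set xs)"
  have "ys = map (\<lambda>j. \<Sum>x\<in>set xs. a (ys ! j) x *\<^sub>R x) [0..<?k]"
    using assms by (intro nth_equalityI) (auto simp flip: a)
  then have "wedge ys = wedge (map (\<lambda>j. \<Sum>x\<in>set xs. a (ys ! j) x *\<^sub>R x) [0..<?k])"
    by (rule arg_cong)
  also have "\<dots> = (\<Sum>f\<in>?F. ?T f)"
    by (rule wedge_sum_expand) simp
  also have "\<dots> = (\<Sum>f | f \<in> ?F \<and> f ` {..<?k} = set xs. ?T f)"
  proof (rule sum.mono_neutral_right)
    show "\<forall>f \<in> ?F - {f. f \<in> ?F \<and> f ` {..<?k} = set xs}. ?T f = 0"
    proof
      fix f assume f: "f \<in> ?F - {f. f \<in> ?F \<and> f ` {..<?k} = set xs}"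
      then have "f ` {..<?k} \<subset> set xs" by auto
      then have "card (f ` {..<?k}) < ?k"
        using psubset_card_mono[of "set xs"] assms by (simp add: distinct_card)
      then show "?T f = 0"
        using f wedge_sum_nonenumeration[of f ?k _ "\<lambda>x. x"] by auto
    qed
  qed (auto intro: finite_PiE)
  finally show ?thesis
    using wedge_sum_enumerations[OF assms(1), of "\<lambda>j. a (ys ! j)" "\<lambda>x. x"] by auto
qed

definition eigenspace ::
  "nat \<Rightarrow> 'd::{finite,linorder} rmat \<Rightarrow> real \<Rightarrow> 'd ext set" where
  "eigenspace k g \<mu> = {x \<in> ext_power k. ext_act g x = \<mu> *\<^sub>R x}"

definition eigen_decomp ::
  "nat \<Rightarrow> 'd::{finite,linorder} rmat \<Rightarrow> 'd ext \<Rightarrow> (real \<Rightarrow> 'd ext) \<Rightarrow> bool" where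
  "eigen_decomp k g x c \<longleftrightarrow>
     finite {\<mu>. c \<mu> \<noteq> 0} \<and> (\<forall>\<mu>. c \<mu> \<in> eigenspace k g \<mu>) \<and> x = (\<Sum>\<mu> | c \<mu> \<noteq> 0. c \<mu>)"

lemma linear_ext_act: "linear (ext_act g)"
  by (rule linearI)
     (simp_all add: ext_act_def algebra_simps sum.distrib scaleR_sum_right)

lemma eigenvectors_sum_zero:
  assumes "finite S" "\<And>\<mu>. \<mu> \<in> S \<Longrightarrow> ext_act g (c \<mu>) = \<mu> *\<^sub>R c \<mu>" "(\<Sum>\<mu>\<in>S. c \<mu>) = 0"
  shows "\<forall>\<mu>\<in>S. c \<mu> = 0"
  using assms
proof (induction S arbitrary: c rule: finite_induct)
  case (insert \<nu> S)
  interpret linear "ext_act g" by (rule linear_ext_act)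
  have "0 = ext_act g (\<Sum>\<mu>\<in>insert \<nu> S. c \<mu>) - \<nu> *\<^sub>R (\<Sum>\<mu>\<in>insert \<nu> S. c \<mu>)"
    by (simp only: insert.prems(2)) (simp add: zero)
  also have "\<dots> = (\<Sum>\<mu>\<in>insert \<nu> S. (\<mu> - \<nu>) *\<^sub>R c \<mu>)"
    by (simp only: sum scaleR_sum_right sum_subtractf[symmetric])
       (intro sum.cong refl, simp add: insert.prems(1) algebra_simps)
  also have "\<dots> = (\<Sum>\<mu>\<in>S. (\<mu> - \<nu>) *\<^sub>R c \<mu>)"
    using insert.hyps by simp
  finally have "\<forall>\<mu>\<in>S. (\<mu> - \<nu>) *\<^sub>R c \<mu> = 0"
    by (intro insert.IH) (auto simp: scale insert.prems(1))
  then have S: "\<forall>\<mu>\<in>S. c \<mu> = 0"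
    using insert.hyps(2) by auto
  then have "c \<nu> = 0"
    using insert.prems(2) insert.hyps by simp
  with S show ?case by simp
qed simp

lemma eigen_decomp_unique:
  assumes c: "eigen_decomp k g x c" and c': "eigen_decomp k g x c'"
  shows "c = c'"
proof
  interpret linear "ext_act g" by (rule linear_ext_act)
  note D = conjunct1 conjunct2[THEN conjunct1, THEN spec] conjunct2[THEN conjunct2]
  note c = D[OF c[unfolded eigen_decomp_def]] and c' = D[OF c'[unfolded eigen_decomp_def]]
  let ?S = "{\<mu>. c \<mu> \<noteq> 0} \<union> {\<mu>. c' \<mu> \<noteq> 0}"
  have fin: "finite ?S"
    using c(1) c'(1) by simp
  have S: "(\<Sum>\<mu>\<in>?S. c \<mu>) = (\<Sum>\<mu> | c \<mu> \<noteq> 0. c \<mu>)" "(\<Sum>\<mu>\<in>?S. c' \<mu>) = (\<Sum>\<mu> | c' \<mu> \<noteq> 0. c' \<mu>)"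
    by (intro sum.mono_neutral_right; use fin in auto)+
  have "(\<Sum>\<mu>\<in>?S. c \<mu>) = (\<Sum>\<mu>\<in>?S. c' \<mu>)"
    unfolding S c(3)[symmetric] c'(3)[symmetric] ..
  then have "(\<Sum>\<mu>\<in>?S. c \<mu> - c' \<mu>) = 0"
    by (simp only: sum_subtractf diff_self)
  moreover have "ext_act g (c \<mu> - c' \<mu>) = \<mu> *\<^sub>R (c \<mu> - c' \<mu>)" for \<mu>
    using c(2) c'(2) by (simp add: eigenspace_def diff scaleR_diff_right)
  ultimately have "\<forall>\<mu>\<in>?S. c \<mu> - c' \<mu> = 0"
    using fin by (intro eigenvectors_sum_zero) auto
  then show "c \<mu> = c' \<mu>" for \<mu>
    by (metis (mono_tags, lifting) UnI1 UnI2 mem_Collect_eq right_minus_eq)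
qed

lemma wedge_axis:
  "wedge (map (\<lambda>i. a i *\<^sub>R axis i 1) (sorted_list_of_set I)) = (\<Prod>i\<in>I. a i) *\<^sub>R axis I 1"
proof -
  let ?xs = "sorted_list_of_set I" and ?k = "card I"
  have "(\<Sum>p | p permutes {..<?k}. of_int (sign p) *
          (\<Prod>j<?k. (a (?xs ! j) *\<^sub>R axis (?xs ! j) (1::real)) $ (sorted_list_of_set J ! p j))) =
        ((\<Prod>i\<in>I. a i) *\<^sub>R axis I 1) $ J" (is "(\<Sum>p | _. of_int (sign p) * ?P p) = _")
    if J: "card J = ?k" for J
  proof -
    let ?ys = "sorted_list_of_set J"
    have prod: "(\<Prod>j<?k. a (?xs ! j)) = (\<Prod>i\<in>I. a i)"
      using bij_betw_nth[of ?xs "{..<?k}" I] by (intro prod.reindex_bij_betw) auto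
    have nz: "I = J \<and> p = id" if p: "p permutes {..<?k}" and "?P p \<noteq> 0" for p
    proof -
      have eq: "?xs ! j = ?ys ! p j" if "j < ?k" for j
      proof -
        have "(a (?xs ! j) *\<^sub>R axis (?xs ! j) (1::real)) $ (?ys ! p j) \<noteq> 0"
          using \<open>?P p \<noteq> 0\<close> that by (meson finite_lessThan lessThan_iff prod_zero)
        then show ?thesis
          by (auto simp: axis_def split: if_splits)
      qed
      have "I \<subseteq> J"
      proof
        fix i assume "i \<in> I"
        then obtain j where j: "j < ?k" "i = ?xs ! j"
          by (metis finite in_set_conv_nth length_sorted_list_of_set set_sorted_list_of_set)
        then have "p j < length ?ys"
          using permutes_in_image[OF p, of j] J by simp
        then have "?ys ! p j \<in> set ?ys" by (rule nth_mem)
        then show "i \<in> J" using eq[OF j(1)] j(2) by simp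
      qed
      then have IJ: "I = J" using J by (intro card_subset_eq) auto
      have "p j = j" for j
      proof (cases "j < ?k")
        case True
        then have "(?xs ! j = ?xs ! p j) = (j = p j)"
          using permutes_in_image[OF p, of j] by (intro nth_eq_iff_index_eq) auto
        moreover have "?xs ! j = ?xs ! p j" using eq[OF True] unfolding IJ .
        ultimately show ?thesis by (rule iffD1[THEN sym])
      qed (use p in \<open>simp add: permutes_not_in\<close>)
      with IJ show ?thesis by auto
    qed
    show ?thesis
    proof (cases "I = J")
      case True
      have "(\<Sum>p | p permutes {..<?k}. of_int (sign p) * ?P p) = (\<Sum>p\<in>{id}. of_int (sign p) * ?P p)"
      proof (intro sum.mono_neutral_right ballI)
        fix p assume "p \<in> {p. p permutes {..<?k}} - {id}"
        then have "?P p = 0" using nz[of p] by blast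
        then show "of_int (sign p) * ?P p = 0" by (simp only: mult_zero_right)
      qed (auto simp: finite_permutations permutes_id)
      then show ?thesis using True prod by simp
    next
      case False
      have "(\<Sum>p | p permutes {..<?k}. of_int (sign p) * ?P p) = 0"
      proof (intro sum.neutral ballI)
        fix p assume "p \<in> {p. p permutes {..<?k}}"
        then have "?P p = 0" using nz[of p] False by blast
        then show "of_int (sign p) * ?P p = 0" by (simp only: mult_zero_right)
      qed
      then show ?thesis using False by (simp add: axis_def)
    qed
  qed
  then show ?thesis
    by (auto simp: vec_eq_iff wedge_def axis_def)
qed

definition flow_weight :: "nat \<Rightarrow> 'd::{finite,linorder} rvec \<Rightarrow> 'd \<Rightarrow> real" where
  "flow_weight m \<omega> i = (if idx i \<le> m then \<omega> $ i else - \<omega> $ i)"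

lemma ext_act_diag_flow:
  "ext_act (diag_flow m \<omega> t) x = (\<chi> I. exp ((\<Sum>i\<in>I. flow_weight m \<omega> i) * t) * x $ I)"
proof -
  have "diag_flow m \<omega> t *v axis i 1 = exp (flow_weight m \<omega> i * t) *\<^sub>R axis i 1" for i
    by (auto simp: vec_eq_iff diag_flow_def flow_weight_def axis_def matrix_vector_mult_def
        if_distrib[where f = "\<lambda>x. _ * x"] cong: if_cong)
  then have x: "ext_act (diag_flow m \<omega> t) x =
      (\<Sum>I\<in>UNIV. (x $ I) *\<^sub>R (\<Prod>i\<in>I. exp (flow_weight m \<omega> i * t)) *\<^sub>R axis I 1)"
    by (simp only: ext_act_def wedge_axis)
  have "ext_act (diag_flow m \<omega> t) x $ J =
      (\<Sum>I\<in>UNIV. if I = J then x $ I * (\<Prod>i\<in>I. exp (flow_weight m \<omega> i * t)) else 0)" for J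
    unfolding x sum_component by (intro sum.cong refl) (simp add: axis_def)
  then show ?thesis
    by (simp add: vec_eq_iff exp_sum sum_distrib_right)
qed

lemma eigen_decomp_diag_flow:
  assumes "x \<in> ext_power k"
  shows "eigen_decomp k (diag_flow m \<omega> t) x
    (\<lambda>\<mu>. \<chi> I. if exp ((\<Sum>i\<in>I. flow_weight m \<omega> i) * t) = \<mu> then x $ I else 0)"
    (is "eigen_decomp _ ?g _ ?c")
proof -
  let ?e = "\<lambda>I. exp ((\<Sum>i\<in>I. flow_weight m \<omega> i) * t)"
  have sub: "{\<mu>. ?c \<mu> \<noteq> 0} \<subseteq> range ?e"
    by (auto simp: vec_eq_iff)
  have "(\<Sum>\<mu> | ?c \<mu> \<noteq> 0. ?c \<mu>) = (\<Sum>\<mu>\<in>range ?e. ?c \<mu>)"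
    using sub by (intro sum.mono_neutral_left) auto
  also have "\<dots> = x"
    unfolding vec_eq_iff sum_component by (simp add: sum.delta' rangeI[of ?e])
  finally have "x = (\<Sum>\<mu> | ?c \<mu> \<noteq> 0. ?c \<mu>)" by (rule sym)
  moreover have "finite {\<mu>. ?c \<mu> \<noteq> 0}"
    using sub by (rule finite_subset) simp
  moreover have "?c \<mu> \<in> eigenspace k ?g \<mu>" for \<mu>
    using assms by (auto simp: eigenspace_def ext_power_def ext_act_diag_flow vec_eq_iff)
  ultimately show ?thesis
    unfolding eigen_decomp_def by blast
qed

text \<open>The decomposition is unique by \<open>eigen_decomp_unique\<close>, and for the flow it exists by
  \<open>eigen_decomp_diag_flow\<close>.\<close>

definition largest_eigenvalue ::
  "nat \<Rightarrow> 'd::{finite,linorder} rmat \<Rightarrow> 'd ext \<Rightarrow> real" where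
  "largest_eigenvalue k g x = Max {\<mu>. (THE c. eigen_decomp k g x c) \<mu> \<noteq> 0}"

text \<open>\<open>v\<^sub>W\<close>, for a chosen basis of \<open>W\<close>; another basis changes it by a nonzero scalar
  (\<open>wedge_change_basis\<close>, applied both ways), which has no effect on \<open>largest_eigenvalue\<close>.\<close>

definition subspace_vector :: "'d::{finite,linorder} rvec set \<Rightarrow> 'd ext" where
  "subspace_vector W =
     wedge (SOME ws. distinct ws \<and> independent (set ws) \<and> span (set ws) = W)"

end

theory Submission
  imports Defs
begin

text \<open>
  If \<open>L\<close> is not connected at \<open>k\<close>, then \<open>\<lambda>\<^sub>k < \<lambda>\<^bsub>k+1\<^esub>\<close> from some time on. The vectors of \<open>\<Lambda>\<close> that
  \<open>a\<^sub>t\<close> maps into \<open>\<lambda>\<^sub>k C\<close> then span a \<open>k\<close>-dimensional subspace which is locally constant in \<open>t\<close>, hence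
  a constant subspace \<open>W\<close>. The eigenvalue hypothesis gives a \<open>k\<close>-element set \<open>I\<close> of coordinates such that
  \<open>W\<close> projects isomorphically onto the \<open>I\<close>-coordinates and \<open>a\<^sub>t\<close> expands the volume of this
  coordinate plane exponentially. So the covolume of \<open>a\<^sub>t(\<Lambda> \<inter> W)\<close> grows, which first bounds \<open>\<lambda>\<^sub>k\<close>
  from below. A packing argument for \<open>\<Lambda>\<close> modulo the \<open>k\<close> short vectors then produces a lattice vector
  that is short but not in \<open>W\<close>, a contradiction.
\<close>

text \<open>The gap between the two minima is not quantitative: lambda_k < lambda_(k+1) says only
  that all lattice vectors of size at most lambda_k lie in \<open>W\<close>. The packing argument
  therefore works at the scale lambda_k, which could a priori tend to 0; this is why a lower bound
  for it has to come first. The test sets are boxes with sides \<open>\<delta>\<close> in the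
  \<open>I\<close>-directions and \<open>\<rho> / \<beta> j\<close> in the others. As the product of
  all \<open>\<beta> i\<close> is 1, their volume is a constant times the product of the
  \<open>\<beta> i\<close> over \<open>I\<close>, which grows exponentially. Two points of such a
  box are close at time t outside \<open>I\<close>, but may be far apart in the
  \<open>I\<close>-directions; subtracting integer multiples of the short vectors repairs this. The
  short vectors vary with t, whereas \<open>\<delta>\<close>, \<open>\<rho>\<close> and the covolume
  bound depend only on \<Lambda>, \<open>W\<close> and the chosen coordinates. The resulting bound
  on the expansion is thus uniform in t.\<close>

subsection \<open>Packings, coverings and boxes\<close>

text \<open>Sort the points of \<open>S\<close> by an element of \<open>L\<close> whose subtraction
  carries them into \<open>F\<close>, and translate each piece. By \<open>pack\<close> the
  translated pieces are disjoint, and translations preserve \<open>lborel\<close>, so a part of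
  \<open>F\<close> has the measure of \<open>S\<close>. No fundamental domain of \<open>L\<close>
  has to be chosen.\<close>

lemma packing_le_covering:
  fixes L S F :: "'a::euclidean_space set"
  assumes L: "countable L" "0 \<in> L" "\<And>x y. x \<in> L \<Longrightarrow> y \<in> L \<Longrightarrow> x - y \<in> L"
    and S: "S \<in> sets borel" and F: "F \<in> sets borel"
    and cover: "\<And>x. x \<in> S \<Longrightarrow> \<exists>l\<in>L. x - l \<in> F"
    and pack: "\<And>x y. x \<in> S \<Longrightarrow> y \<in> S \<Longrightarrow> x - y \<in> L \<Longrightarrow> x = y"
  shows "emeasure lborel S \<le> emeasure lborel F"
proof -
  define g where "g = from_nat_into L"
  have g: "range g = L"
    unfolding g_def using L by (intro range_from_nat_into) auto
  then have gL: "g n \<in> L" for n by auto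
  define X where "X n = S \<inter> (\<lambda>x. x - g n) -` F" for n
  \<comment> \<open>Several translations may carry a point into \<open>F\<close>;
    \<open>disjointed\<close> keeps the first one.\<close>
  define Y where "Y = disjointed X"
  define T where "T n = (+) (g n) -` Y n" for n
  have X: "X n \<in> sets borel" for n
    unfolding X_def using S F by (intro sets.Int measurable_sets_borel[of _ borel]) auto
  have Y: "Y n \<in> sets borel" for n
    unfolding Y_def using sets.range_disjointed_sets[of X borel] X by blast
  have YX: "Y n \<subseteq> X n" for n
    unfolding Y_def by (rule disjointed_subset)
  have T: "T n \<in> sets borel" for n
    unfolding T_def using Y by (intro measurable_sets_borel[of _ borel]) auto
  have eT: "emeasure lborel (T n) = emeasure lborel (Y n)" for n
  proof -
    have "emeasure lborel (Y n) = emeasure (distr lborel borel ((+) (g n))) (Y n)"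
      by (simp add: lborel_distr_plus)
    also have "\<dots> = emeasure lborel (T n)"
      unfolding T_def using Y by (subst emeasure_distr) auto
    finally show ?thesis by simp
  qed
  have SY: "S = (\<Union>n. Y n)"
  proof -
    have "(\<Union>n. X n) = S"
    proof (intro equalityI subsetI)
      fix x assume x: "x \<in> S"
      then obtain l where "l \<in> L" "x - l \<in> F" using cover by blast
      then show "x \<in> (\<Union>n. X n)" using x g by (auto simp: X_def)
    qed (auto simp: X_def)
    then show ?thesis by (simp add: Y_def UN_disjointed_eq)
  qed
  have disjY: "disjoint_family Y"
    unfolding Y_def by (rule disjoint_family_disjointed)
  have disjT: "disjoint_family T"
  proof -
    have "n = k" if "x \<in> T n" "x \<in> T k" for x n k
    proof -
      have *: "g n + x \<in> Y n" "g k + x \<in> Y k" using that by (auto simp: T_def)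
      then have "g n + x \<in> S" "g k + x \<in> S" using SY by auto
      moreover have "(g n + x) - (g k + x) \<in> L" using L(3)[OF gL gL, of n k] by simp
      ultimately have "g n + x = g k + x" by (rule pack)
      then show ?thesis using * disjY by (auto simp: disjoint_family_on_def)
    qed
    then show ?thesis by (auto simp: disjoint_family_on_def)
  qed
  have "emeasure lborel S = (\<Sum>n. emeasure lborel (Y n))"
    unfolding SY using Y disjY by (intro suminf_emeasure[symmetric]) auto
  also have "\<dots> = (\<Sum>n. emeasure lborel (T n))"
    by (simp add: eT)
  also have "\<dots> = emeasure lborel (\<Union>n. T n)"
    using T disjT by (intro suminf_emeasure) auto
  also have "\<dots> \<le> emeasure lborel F"
  proof (intro emeasure_mono subsetI)
    fix x assume "x \<in> (\<Union>n. T n)"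
    then obtain n where "g n + x \<in> X n" using YX by (auto simp: T_def)
    then show "x \<in> F" by (simp add: X_def)
  qed (use F in simp)
  finally show ?thesis .
qed

lemma emeasure_lborel_box_cart:
  fixes a b :: "real^'n"
  assumes "\<And>i. a $ i \<le> b $ i"
  shows "emeasure lborel (cbox a b) = ennreal (\<Prod>i\<in>UNIV. b $ i - a $ i)"
    and "emeasure lborel (box a b) = ennreal (\<Prod>i\<in>UNIV. b $ i - a $ i)"
proof -
  have "cbox a b \<noteq> {}" using assms by (simp add: interval_ne_empty_cart)
  then have "measure lborel (cbox a b) = (\<Prod>i\<in>UNIV. b $ i - a $ i)"
    by (rule content_cbox_cart)
  then show *: "emeasure lborel (cbox a b) = ennreal (\<Prod>i\<in>UNIV. b $ i - a $ i)"
    using emeasure_lborel_cbox_finite[of a b] by (simp add: emeasure_eq_ennreal_measure less_top)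
  show "emeasure lborel (box a b) = ennreal (\<Prod>i\<in>UNIV. b $ i - a $ i)"
    unfolding *[symmetric] by (simp only: emeasure_lborel_box_eq emeasure_lborel_cbox_eq)
qed

subsection \<open>Lattices and successive minima\<close>

lemma countable_integer_vectors: "countable {z :: real^'n. \<forall>i. z $ i \<in> \<int>}"
proof -
  have "{z :: real^'n. \<forall>i. z $ i \<in> \<int>} \<subseteq> range (\<lambda>f :: 'n \<Rightarrow> int. \<chi> i. of_int (f i))"
  proof
    fix z :: "real^'n" assume "z \<in> {z. \<forall>i. z $ i \<in> \<int>}"
    then have "z = (\<chi> i. of_int \<lfloor>z $ i\<rfloor>)"
      by (simp add: vec_eq_iff)
    then show "z \<in> range (\<lambda>f :: 'n \<Rightarrow> int. \<chi> i. of_int (f i))"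
      by (rule range_eqI[where f = "\<lambda>f. \<chi> i. of_int (f i)"])
  qed
  then show ?thesis
    by (rule countable_subset) simp
qed

lemma finite_integer_vectors: "finite {z :: real^'n. \<forall>i. z $ i \<in> \<int> \<and> \<bar>z $ i\<bar> \<le> C}"
proof -
  have "{z :: real^'n. \<forall>i. z $ i \<in> \<int> \<and> \<bar>z $ i\<bar> \<le> C}
      \<subseteq> vec_lambda ` (\<Pi>\<^sub>E i\<in>UNIV. of_int ` {-\<lceil>C\<rceil>..\<lceil>C\<rceil>})"
  proof
    fix z :: "real^'n" assume "z \<in> {z. \<forall>i. z $ i \<in> \<int> \<and> \<bar>z $ i\<bar> \<le> C}"
    then have z: "z $ i \<in> \<int>" "\<bar>z $ i\<bar> \<le> C" for i by auto
    have "z $ i \<in> of_int ` {-\<lceil>C\<rceil>..\<lceil>C\<rceil>}" for i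
    proof
      show "z $ i = of_int \<lfloor>z $ i\<rfloor>" using z(1) by (metis of_int_floor)
      show "\<lfloor>z $ i\<rfloor> \<in> {-\<lceil>C\<rceil>..\<lceil>C\<rceil>}" using z(2)[of i] by (auto simp: abs_le_iff) linarith+
    qed
    then show "z \<in> vec_lambda ` (\<Pi>\<^sub>E i\<in>UNIV. of_int ` {-\<lceil>C\<rceil>..\<lceil>C\<rceil>})"
      by (intro image_eqI[of _ _ "vec_nth z"]) auto
  qed
  then show ?thesis
    by (rule finite_subset) (auto intro!: finite_imageI finite_PiE)
qed

text \<open>The inverse is carried as a parameter because membership then becomes integrality of
  \<open>B' *v v\<close>, and the image under the flow is again an instance with explicit
  matrices.\<close>

locale lattice_basis =
  fixes \<Lambda> :: "(real^'n) set" and B B' :: "real^'n^'n"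
  assumes \<Lambda>_eq: "\<Lambda> = (*v) B ` {z. \<forall>i. z $ i \<in> \<int>}"
    and B'B: "B' ** B = mat 1" and BB': "B ** B' = mat 1"
begin

lemma B'_B [simp]: "B' *v (B *v x) = x" and B_B' [simp]: "B *v (B' *v x) = x"
  by (simp_all add: matrix_vector_mul_assoc B'B BB')

lemma mem_iff: "v \<in> \<Lambda> \<longleftrightarrow> (\<forall>i. (B' *v v) $ i \<in> \<int>)"
proof
  assume "\<forall>i. (B' *v v) $ i \<in> \<int>"
  then show "v \<in> \<Lambda>"
    unfolding \<Lambda>_eq by (intro image_eqI[of _ _ "B' *v v"]) auto
qed (auto simp: \<Lambda>_eq)

lemma zero_mem: "0 \<in> \<Lambda>"
  by (simp add: mem_iff)

lemma diff_mem: "x \<in> \<Lambda> \<Longrightarrow> y \<in> \<Lambda> \<Longrightarrow> x - y \<in> \<Lambda>"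
  by (simp add: mem_iff matrix_vector_mult_diff_distrib)

lemma add_mem: "x \<in> \<Lambda> \<Longrightarrow> y \<in> \<Lambda> \<Longrightarrow> x + y \<in> \<Lambda>"
  by (simp add: mem_iff matrix_vector_right_distrib)

lemma scale_mem: "x \<in> \<Lambda> \<Longrightarrow> c \<in> \<int> \<Longrightarrow> c *\<^sub>R x \<in> \<Lambda>"
  by (simp add: mem_iff matrix_vector_mult_scaleR)

lemma sum_mem: "(\<And>i. i \<in> A \<Longrightarrow> f i \<in> \<Lambda>) \<Longrightarrow> sum f A \<in> \<Lambda>"
  by (induction A rule: infinite_finite_induct) (auto simp: zero_mem add_mem)

lemma countable: "countable \<Lambda>"
  unfolding \<Lambda>_eq by (intro countable_image countable_integer_vectors)

lemma discrete:
  obtains \<eta> where "\<eta> > 0" "\<And>v. v \<in> \<Lambda> \<Longrightarrow> norm v < \<eta> \<Longrightarrow> v = 0"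
proof -
  obtain K where K: "K > 0" "\<And>x. norm (B' *v x) \<le> K * norm x"
    using linear_bounded_pos[OF matrix_vector_mul_linear[of B']] by blast
  show ?thesis
  proof
    show "1 / K > 0" using K by simp
    fix v assume v: "v \<in> \<Lambda>" "norm v < 1 / K"
    have "(B' *v v) $ i = 0" for i
    proof -
      have "\<bar>(B' *v v) $ i\<bar> \<le> K * norm v"
        using component_le_norm_cart[of "B' *v v" i] K(2)[of v] by linarith
      also have "\<dots> < 1" using v(2) K(1) by (simp add: field_simps)
      finally have "\<bar>(B' *v v) $ i\<bar> < 1" .
      moreover have "(B' *v v) $ i \<in> \<int>" using v(1) mem_iff by simp
      ultimately show ?thesis using Ints_nonzero_abs_less1 by blast
    qed
    then have "B' *v v = 0" by (simp add: vec_eq_iff)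
    then show "v = 0" by (metis B_B' matrix_vector_mult_0_right)
  qed
qed

lemma finite_bounded: "finite {v\<in>\<Lambda>. \<forall>i. \<bar>v $ i\<bar> \<le> R}"
proof -
  obtain K where K: "K > 0" "\<And>x. norm (B' *v x) \<le> K * norm x"
    using linear_bounded_pos[OF matrix_vector_mul_linear[of B']] by blast
  let ?C = "K * (CARD('n) * R)"
  have "{v\<in>\<Lambda>. \<forall>i. \<bar>v $ i\<bar> \<le> R} \<subseteq> (*v) B ` {z. \<forall>i. z $ i \<in> \<int> \<and> \<bar>z $ i\<bar> \<le> ?C}"
  proof
    fix v assume "v \<in> {v\<in>\<Lambda>. \<forall>i. \<bar>v $ i\<bar> \<le> R}"
    then have v: "v \<in> \<Lambda>" "\<And>i. \<bar>v $ i\<bar> \<le> R" by auto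
    have "norm v \<le> (\<Sum>i\<in>UNIV. \<bar>v $ i\<bar>)" by (rule norm_le_l1_cart)
    also have "\<dots> \<le> (\<Sum>i\<in>(UNIV :: 'n set). R)" by (intro sum_mono v)
    finally have "K * norm v \<le> ?C" using K by simp
    then have "\<bar>(B' *v v) $ i\<bar> \<le> ?C" for i
      using component_le_norm_cart[of "B' *v v" i] K(2)[of v] by linarith
    then show "v \<in> (*v) B ` {z. \<forall>i. z $ i \<in> \<int> \<and> \<bar>z $ i\<bar> \<le> ?C}"
      using v(1) by (intro image_eqI[of _ _ "B' *v v"]) (auto simp: mem_iff)
  qed
  then show ?thesis
    using finite_integer_vectors finite_subset by blast
qed

lemma cobounded:
  obtains R where "\<And>x. \<exists>l\<in>\<Lambda>. norm (x - l) \<le> R"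
proof -
  obtain K where K: "K > 0" "\<And>x. norm (B *v x) \<le> K * norm x"
    using linear_bounded_pos[OF matrix_vector_mul_linear[of B]] by blast
  have "\<exists>l\<in>\<Lambda>. norm (x - l) \<le> K * real CARD('n)" for x
  proof
    define z where "z = (\<chi> i. real_of_int \<lfloor>(B' *v x) $ i\<rfloor>)"
    show "B *v z \<in> \<Lambda>" by (simp add: mem_iff z_def)
    have "x - B *v z = B *v (B' *v x - z)"
      by (simp add: matrix_vector_mult_diff_distrib)
    moreover have "norm (B' *v x - z) \<le> CARD('n)"
    proof -
      have "norm (B' *v x - z) \<le> (\<Sum>i\<in>UNIV. \<bar>(B' *v x - z) $ i\<bar>)" by (rule norm_le_l1_cart)
      also have "\<dots> \<le> (\<Sum>i\<in>(UNIV :: 'n set). 1)"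
        by (intro sum_mono) (simp add: z_def, linarith)
      finally show ?thesis by simp
    qed
    ultimately show "norm (x - B *v z) \<le> K * real CARD('n)"
      using K(2)[of "B' *v x - z"] K(1) by (smt (verit) mult_left_mono)
  qed
  then show ?thesis by (rule that)
qed

lemma span_eq_UNIV: "span \<Lambda> = UNIV"
proof -
  have "x \<in> span \<Lambda>" for x
  proof -
    have "x = B *v (\<Sum>i\<in>UNIV. (B' *v x) $ i *\<^sub>R axis i 1)"
      using basis_expansion[of "B' *v x"] by (simp add: scalar_mult_eq_scaleR)
    also have "\<dots> = (\<Sum>i\<in>UNIV. (B' *v x) $ i *\<^sub>R (B *v axis i 1))"
      by (simp add: linear_sum[OF matrix_vector_mul_linear] matrix_vector_mult_scaleR)
    also have "\<dots> \<in> span \<Lambda>"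
      by (intro span_sum span_scale span_base) (simp add: mem_iff axis_def)
    finally show ?thesis .
  qed
  then show ?thesis by auto
qed

end

lemma unimodular_lattice_basis:
  assumes "unimodular_lattice \<Lambda>"
  obtains B B' where "lattice_basis \<Lambda> B B'"
proof -
  obtain B where B: "\<bar>det B\<bar> = 1" "\<Lambda> = (*v) B ` {z. \<forall>i. z $ i \<in> \<int>}"
    using assms unfolding unimodular_lattice_def by blast
  then have "invertible B" by (auto simp: invertible_det_nz)
  then show ?thesis using that B(2) unfolding invertible_def lattice_basis_def by blast
qed

lemma lattice_basis_image:
  assumes "lattice_basis \<Lambda> B B'" "A' ** A = mat 1" "A ** A' = mat 1"
  shows "lattice_basis ((*v) A ` \<Lambda>) (A ** B) (B' ** A')"
proof -
  interpret lattice_basis \<Lambda> B B' by fact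
  have "B' ** A' ** (A ** B) = B' ** (A' ** A) ** B" "A ** B ** (B' ** A') = A ** (B ** B') ** A'"
    by (simp_all only: matrix_mul_assoc)
  then show ?thesis
    by unfold_locales (auto simp: \<Lambda>_eq image_image matrix_vector_mul_assoc assms B'B BB')
qed

section \<open>Attainment of the successive minima\<close>

lemma scaled_unit_cube: "r > 0 \<Longrightarrow> x \<in> (*\<^sub>R) r ` unit_cube \<longleftrightarrow> (\<forall>i. \<bar>x $ i\<bar> \<le> r / 2)"
proof
  assume r: "r > 0" "\<forall>i. \<bar>x $ i\<bar> \<le> r / 2"
  then show "x \<in> (*\<^sub>R) r ` unit_cube"
    by (intro image_eqI[of _ _ "(1 / r) *\<^sub>R x"]) (auto simp: unit_cube_def field_simps abs_mult)
qed (auto simp: unit_cube_def abs_mult field_simps)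

text \<open>A \<open>LEAST\<close> over the reals need not be attained. Here \<open>gauge S\<close>
  is the side length at which the cube first contains \<open>S\<close>, and only finitely many
  candidate sets have gauge at most that of a fixed \<open>S0\<close>, so some \<open>S1\<close>
  realizes the minimum.\<close>

lemma (in lattice_basis) succ_min_works:
  assumes i: "1 \<le> i" "i \<le> CARD('n)"
  shows "succ_min i \<Lambda> > 0"
    and "\<exists>S\<subseteq>\<Lambda>. independent S \<and> card S = i \<and> (\<forall>v\<in>S. \<forall>l. \<bar>v $ l\<bar> \<le> succ_min i \<Lambda> / 2)"
    and "\<lbrakk>r > 0; S \<subseteq> \<Lambda>; independent S; card S = i; \<And>v l. v \<in> S \<Longrightarrow> \<bar>v $ l\<bar> \<le> r / 2\<rbrakk>
      \<Longrightarrow> succ_min i \<Lambda> \<le> r"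
proof -
  let ?P = "\<lambda>r. r > 0 \<and> (\<exists>S\<subseteq>\<Lambda> \<inter> (*\<^sub>R) r ` unit_cube. independent S \<and> card S = i)"
  define gauge where "gauge S = Max ((\<lambda>(v, l). 2 * \<bar>v $ l\<bar>) ` (S \<times> UNIV))" for S :: "(real^'n) set"
  have gauge_le: "gauge S \<le> r \<longleftrightarrow> (\<forall>v\<in>S. \<forall>l. \<bar>v $ l\<bar> \<le> r / 2)" if "independent S" "card S = i" for S r
  proof -
    have "finite S" "S \<noteq> {}" using that i independent_imp_finite by auto
    then show ?thesis unfolding gauge_def by (subst Max_le_iff) (auto simp: field_simps)
  qed
  have gauge_pos: "gauge S > 0" if S: "independent S" "card S = i" for S
  proof -
    obtain v where v: "v \<in> S" using S i by (metis card.empty equals0I not_one_le_zero)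
    then have "v \<noteq> 0" using S dependent_zero by blast
    then obtain l where "v $ l \<noteq> 0" by (auto simp: vec_eq_iff)
    moreover have "\<bar>v $ l\<bar> \<le> gauge S / 2" using gauge_le[OF S, of "gauge S"] v by blast
    ultimately show ?thesis by linarith
  qed
  have P_iff: "?P r \<longleftrightarrow> (\<exists>S\<subseteq>\<Lambda>. independent S \<and> card S = i \<and> gauge S \<le> r)" for r
  proof
    assume "?P r"
    then obtain S where S: "r > 0" "S \<subseteq> \<Lambda> \<inter> (*\<^sub>R) r ` unit_cube" "independent S" "card S = i" by blast
    then have "\<bar>v $ l\<bar> \<le> r / 2" if "v \<in> S" for v l
      using that scaled_unit_cube[OF S(1), of v] by blast
    then have "gauge S \<le> r" using S gauge_le by blast
    then show "\<exists>S\<subseteq>\<Lambda>. independent S \<and> card S = i \<and> gauge S \<le> r" using S by blast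
  next
    assume "\<exists>S\<subseteq>\<Lambda>. independent S \<and> card S = i \<and> gauge S \<le> r"
    then obtain S where S: "S \<subseteq> \<Lambda>" "independent S" "card S = i" "gauge S \<le> r" by blast
    then have r: "r > 0" using gauge_pos[of S] by linarith
    have "S \<subseteq> \<Lambda> \<inter> (*\<^sub>R) r ` unit_cube"
      using S gauge_le[of S r] by (auto simp: scaled_unit_cube[OF r])
    then show "?P r" using r S by blast
  qed
  obtain S0 where S0: "S0 \<subseteq> \<Lambda>" "independent S0" "card S0 = i"
  proof -
    obtain A where A: "A \<subseteq> \<Lambda>" "independent A" "\<Lambda> \<subseteq> span A" "card A = dim \<Lambda>"
      using basis_exists by blast
    have "dim \<Lambda> = CARD('n)"
      using span_eq_UNIV by (metis dim_UNIV dim_span DIM_cart DIM_real mult.right_neutral)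
    then obtain T where "T \<subseteq> A" "card T = i" 
      using obtain_subset_with_card_n[of i A] A i by auto
    then show ?thesis using that[of T] A independent_mono by blast
  qed
  define Cand where "Cand = {S. S \<subseteq> \<Lambda> \<and> independent S \<and> card S = i \<and> gauge S \<le> gauge S0}"
  have "Cand \<subseteq> Pow {v\<in>\<Lambda>. \<forall>l. \<bar>v $ l\<bar> \<le> gauge S0 / 2}"
    using gauge_le by (auto simp: Cand_def)
  then have "finite Cand"
    using finite_bounded finite_subset by blast
  moreover have "Cand \<noteq> {}" using S0 by (auto simp: Cand_def)
  ultimately obtain S1 where S1: "S1 \<in> Cand" "\<And>S. S \<in> Cand \<Longrightarrow> gauge S1 \<le> gauge S"
    using arg_min_if_finite[of Cand gauge] by (metis not_le)
  then have S1': "S1 \<subseteq> \<Lambda>" "independent S1" "card S1 = i" "gauge S1 \<le> gauge S0"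
    by (auto simp: Cand_def)
  have min: "gauge S1 \<le> r" if "?P r" for r
    using that S1 S1' unfolding P_iff Cand_def by (smt (verit) mem_Collect_eq)
  have sm: "succ_min i \<Lambda> = gauge S1"
    unfolding succ_min_def
  proof (rule Least_equality)
    show "?P (gauge S1)" unfolding P_iff using S1' by blast
  qed (rule min)
  show "succ_min i \<Lambda> > 0" unfolding sm using gauge_pos S1' by blast
  show "\<exists>S\<subseteq>\<Lambda>. independent S \<and> card S = i \<and> (\<forall>v\<in>S. \<forall>l. \<bar>v $ l\<bar> \<le> succ_min i \<Lambda> / 2)"
    unfolding sm using S1' gauge_le by blast
  show "succ_min i \<Lambda> \<le> r" if "r > 0" "S \<subseteq> \<Lambda>" "independent S" "card S = i"
    "\<And>v l. v \<in> S \<Longrightarrow> \<bar>v $ l\<bar> \<le> r / 2"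
  proof -
    have "gauge S \<le> r" using gauge_le[OF that(3,4)] that(5) by simp
    then have "?P r" unfolding P_iff using that(2-4) by blast
    then show ?thesis unfolding sm by (rule min)
  qed
qed

subsection \<open>Expanding coordinates of a subspace\<close>

text \<open>Send the vectors by a linear map to distinct unit vectors. By
  \<open>ext_act_wedge\<close> the wedge then goes to a basis vector of the exterior power, so it
  cannot be 0.\<close>

lemma wedge_independent_nonzero:
  assumes ws: "distinct ws" "independent (set ws)"
  shows "wedge ws \<noteq> (0 :: 'd::{finite,linorder} ext)"
proof -
  have "length ws \<le> CARD('d)"
    using independent_bound[OF ws(2)] distinct_card[OF ws(1)] by simp
  then obtain I :: "'d set" where I: "card I = length ws"
    using obtain_subset_with_card_n[of "length ws" UNIV] by auto
  let ?xs = "sorted_list_of_set I"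
  let ?h = "\<lambda>v. axis (the (map_of (zip ws ?xs) v)) (1::real)"
  have "\<exists>g. linear g \<and> (\<forall>v\<in>set ws. g v = ?h v)"
    by (rule linear_independent_extend[OF ws(2)])
  then obtain g where g: "linear g" "\<forall>v\<in>set ws. g v = ?h v"
    by (elim exE conjE)
  \<comment> \<open>The factor 1 gives the list the shape that \<open>wedge_axis\<close>
    expects.\<close>
  have "map ((*v) (matrix g)) ws = map (\<lambda>i. 1 *\<^sub>R axis i 1) ?xs"
  proof (rule nth_equalityI)
    fix j assume "j < length (map ((*v) (matrix g)) ws)"
    then have j: "j < length ws" by simp
    then have "map_of (zip ws ?xs) (ws ! j) = Some (?xs ! j)"
      using I ws by (intro map_of_zip_nth) auto
    then have "g (ws ! j) = axis (?xs ! j) 1" using g(2) j by auto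
    then show "map ((*v) (matrix g)) ws ! j = map (\<lambda>i. 1 *\<^sub>R axis i 1) ?xs ! j"
      using j I fun_cong[OF matrix_vector_mul(2)[OF g(1)]] by simp
  qed (use I in simp)
  then have "ext_act (matrix g) (wedge ws) = wedge (map (\<lambda>i. 1 *\<^sub>R axis i 1) ?xs)"
    by (simp only: ext_act_wedge)
  also have "\<dots> = axis I 1"
    by (simp only: wedge_axis) simp
  finally have "ext_act (matrix g) (wedge ws) \<noteq> 0"
    by (simp add: axis_eq_0_iff)
  then show ?thesis
    using linear_0[OF linear_ext_act, of "matrix g"] by auto
qed

lemma subspace_vector_basis:
  assumes "subspace (W :: 'd::{finite,linorder} rvec set)"
  obtains ws where "distinct ws" "independent (set ws)" "span (set ws) = W"
    "subspace_vector W = wedge ws"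
proof -
  let ?P = "\<lambda>ws. distinct ws \<and> independent (set ws) \<and> span (set ws) = W"
  obtain B where B: "B \<subseteq> W" "independent B" "W \<subseteq> span B" "card B = dim W"
    using basis_exists by blast
  have "span B = W" using B assms by (simp add: span_subspace)
  moreover obtain ws where "set ws = B" "distinct ws"
    using finite_distinct_list[OF independent_imp_finite[OF B(2)]] by blast
  ultimately have "?P ws" using B by simp
  then have "?P (SOME ws. ?P ws)" by (rule someI)
  then show ?thesis using that unfolding subspace_vector_def by blast
qed

text \<open>The minor of \<open>vs\<close> on \<open>I\<close> has a zero column, coming from
  \<open>v\<close>, and passing to \<open>ws\<close> only rescales the wedge. Read contrapositively,
  a nonzero minor makes the projection to the \<open>I\<close>-coordinates injective.\<close>

lemma wedge_coordinate_zero: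
  assumes "v \<in> set vs" "length vs = length ws" "distinct vs" "set ws \<subseteq> span (set vs)"
    and "\<And>i. i \<in> I \<Longrightarrow> v $ i = 0"
  shows "wedge ws $ I = 0"
proof -
  obtain j where j: "j < length vs" "vs ! j = v"
    using assms(1) by (auto simp: in_set_conv_nth)
  have "wedge vs $ I = 0"
  proof (cases "card I = length vs")
    case True
    have "(\<Prod>l<length vs. (vs ! l) $ (sorted_list_of_set I ! p l)) = 0"
      if p: "p permutes {..<length vs}" for p
    proof (rule prod_zero)
      have "p j < length (sorted_list_of_set I)"
        using permutes_in_image[OF p, of j] j True by simp
      then have "sorted_list_of_set I ! p j \<in> set (sorted_list_of_set I)" by (rule nth_mem)
      then show "\<exists>l\<in>{..<length vs}. (vs ! l) $ (sorted_list_of_set I ! p l) = 0"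
        using j assms(5) by auto
    qed simp
    then have "(\<Sum>p | p permutes {..<length vs}. of_int (sign p) *
        (\<Prod>l<length vs. (vs ! l) $ (sorted_list_of_set I ! p l))) = 0"
      by (intro sum.neutral) simp
    then show ?thesis using True by (simp add: wedge_def)
  qed (simp add: wedge_def)
  moreover obtain r where "wedge ws = r *\<^sub>R wedge vs"
    using wedge_change_basis[of vs ws] assms by auto
  ultimately show ?thesis by simp
qed

text \<open>The flow acts diagonally on the \<open>e_I\<close>, so grouping coordinates by
  eigenvalue gives a decomposition, and \<open>eigen_decomp_unique\<close> identifies it with the
  one chosen by \<open>THE\<close>. Several index sets may share the top eigenvalue; one with a
  nonzero coefficient is enough.\<close>

lemma largest_eigenvalue_coordinate:
  assumes x: "x \<in> ext_power k" "x \<noteq> 0"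
  obtains I where "x $ I \<noteq> 0"
    "largest_eigenvalue k (diag_flow m \<omega> t) x = exp ((\<Sum>i\<in>I. flow_weight m \<omega> i) * t)"
proof -
  let ?g = "diag_flow m \<omega> t"
  define c where "c = (\<lambda>\<mu>. \<chi> I. if exp ((\<Sum>i\<in>I. flow_weight m \<omega> i) * t) = \<mu> then x $ I else 0)"
  have c: "eigen_decomp k ?g x c"
    using eigen_decomp_diag_flow[OF x(1)] by (simp add: c_def)
  then have "(THE c. eigen_decomp k ?g x c) = c"
    by (rule the_equality[where P = "eigen_decomp k ?g x"]) (rule eigen_decomp_unique[OF _ c])
  then have eq: "largest_eigenvalue k ?g x = Max {\<mu>. c \<mu> \<noteq> 0}"
    by (simp add: largest_eigenvalue_def)
  have fin: "finite {\<mu>. c \<mu> \<noteq> 0}" and sum: "x = (\<Sum>\<mu> | c \<mu> \<noteq> 0. c \<mu>)"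
    using c unfolding eigen_decomp_def by auto
  \<comment> \<open>\<open>Max\<close> is informative only on a nonempty set; this is where
    \<open>x \<noteq> 0\<close> enters.\<close>
  have "{\<mu>. c \<mu> \<noteq> 0} \<noteq> {}"
  proof
    assume "{\<mu>. c \<mu> \<noteq> 0} = {}"
    then show False using sum x(2) by (simp only: sum.empty)
  qed
  with fin have "Max {\<mu>. c \<mu> \<noteq> 0} \<in> {\<mu>. c \<mu> \<noteq> 0}" by (rule Max_in)
  then obtain I where "c (Max {\<mu>. c \<mu> \<noteq> 0}) $ I \<noteq> 0"
    by (auto simp: vec_eq_iff)
  then have "exp ((\<Sum>i\<in>I. flow_weight m \<omega> i) * t) = Max {\<mu>. c \<mu> \<noteq> 0}" "x $ I \<noteq> 0"
    unfolding c_def by (auto split: if_splits)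
  then show ?thesis using that eq by simp
qed

text \<open>The index set of the top eigenvalue has a nonzero minor. A nonzero vector of
  \<open>W\<close> vanishing on it could be completed to a basis of \<open>W\<close>, which would
  force this minor to be 0.\<close>

lemma expanding_coordinates:
  fixes W :: "'d::{finite,linorder} rvec set"
  assumes W: "subspace W" "dim W = k"
    and ev: "largest_eigenvalue k (diag_flow m \<omega> 1) (subspace_vector W) > 1"
  obtains I where "card I = k" "(\<Sum>i\<in>I. flow_weight m \<omega> i) > 0"
    "\<forall>x\<in>W. (\<forall>i\<in>I. x $ i = 0) \<longrightarrow> x = 0"
proof -
  obtain ws where ws: "distinct ws" "independent (set ws)" "span (set ws) = W"
    "subspace_vector W = wedge ws"
    using subspace_vector_basis[OF W(1)] .
  have len: "length ws = k"
    using W ws dim_span_eq_card_independent[OF ws(2)] distinct_card[OF ws(1)] by simp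
  have "wedge ws \<in> ext_power k"
    by (simp add: ext_power_def wedge_def len)
  then obtain I where I: "wedge ws $ I \<noteq> 0"
    "largest_eigenvalue k (diag_flow m \<omega> 1) (wedge ws) = exp ((\<Sum>i\<in>I. flow_weight m \<omega> i) * 1)"
    by (rule largest_eigenvalue_coordinate[OF _ wedge_independent_nonzero[OF ws(1,2)]])
  show ?thesis
  proof
    show "card I = k"
      using I(1) len by (auto simp: wedge_def split: if_splits)
    show "(\<Sum>i\<in>I. flow_weight m \<omega> i) > 0"
      using I(2) ev ws(4) by simp
    show "\<forall>x\<in>W. (\<forall>i\<in>I. x $ i = 0) \<longrightarrow> x = 0"
    proof (intro ballI impI, rule ccontr)
      fix x assume x: "x \<in> W" "\<forall>i\<in>I. x $ i = 0"
      assume "x \<noteq> 0"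
      then obtain B where B: "{x} \<subseteq> B" "B \<subseteq> W" "independent B" "W \<subseteq> span B"
        using maximal_independent_subset_extend[of "{x}" W] x by auto
      have "dim W = card B"
        using B by (intro dim_unique) auto
      obtain vs where vs: "set vs = B" "distinct vs"
        using finite_distinct_list[OF independent_imp_finite[OF B(3)]] by blast
      have "length vs = length ws"
        using \<open>dim W = card B\<close> W(2) len distinct_card[OF vs(2)] vs(1) by simp
      moreover have "set ws \<subseteq> span (set vs)"
        using B(4) vs(1) span_superset[of "set ws"] unfolding ws(3) by simp
      moreover have "x \<in> set vs" using vs(1) B(1) by simp
      ultimately have "wedge ws $ I = 0"
        using wedge_coordinate_zero[of x vs ws I] vs(2) x(2) by simp
      then show False using I(1) by simp
    qed
  qed
qed

text \<open>\<open>W\<close> is a graph over the \<open>I\<close>-coordinates, and \<open>g\<close>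
  lifts a coordinate vector to it. The map x - g (p x) + p x is the shear that slides the graph onto
  the coordinate plane: since \<open>p (g (p x)) = p x\<close>, it moves points only in directions
  outside \<open>I\<close>, and exchanging the roles of \<open>p y\<close> and
  \<open>g (p y)\<close> undoes it.\<close>

lemma transversal_coordinates:
  fixes W :: "(real^'n) set"
  assumes W: "subspace W" "dim W = card I"
    and transversal: "\<And>x. x \<in> W \<Longrightarrow> (\<And>i. i \<in> I \<Longrightarrow> x $ i = 0) \<Longrightarrow> x = 0"
  obtains \<phi> \<psi> :: "real^'n \<Rightarrow> real^'n" where "linear \<phi>" "linear \<psi>"
    "\<And>x. \<psi> (\<phi> x) = x" "\<And>y. \<phi> (\<psi> y) = y"
    "\<And>x i. i \<in> I \<Longrightarrow> \<phi> x $ i = x $ i"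
    "\<And>x. x \<in> W \<longleftrightarrow> (\<forall>j. j \<notin> I \<longrightarrow> \<phi> x $ j = 0)"
    "\<And>j. j \<notin> I \<Longrightarrow> \<phi> (axis j 1) = axis j 1"
proof -
  define p where "p x = (\<chi> i. if i \<in> I then x $ i else 0)" for x :: "real^'n"
  have p: "linear p" by (rule linearI) (auto simp: p_def vec_eq_iff)
  have pI: "p x $ i = x $ i" if "i \<in> I" for x i using that by (simp add: p_def)
  have p_id: "p x = x" if "\<forall>j. j \<notin> I \<longrightarrow> x $ j = 0" for x
    using that by (simp add: p_def vec_eq_iff)
  have pp: "p (p x) = p x" for x by (simp add: p_def vec_eq_iff)
  have inj: "inj_on p W"
  proof (rule inj_onI)
    fix x y assume xy: "x \<in> W" "y \<in> W" "p x = p y"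
    then have "x $ i = y $ i" if "i \<in> I" for i
      using that by (auto simp: p_def vec_eq_iff) metis
    then have "x - y = 0"
      using xy W by (intro transversal) (auto simp: subspace_diff)
    then show "x = y" by simp
  qed
  have "\<exists>g. range g \<subseteq> W \<and> linear g \<and> (\<forall>x\<in>W. g (p x) = x)"
    using p W(1) inj by (rule linear_exists_left_inverse_on)
  then obtain g where g: "range g \<subseteq> W" "linear g" "\<forall>x\<in>W. g (p x) = x"
    by (elim exE conjE)
  \<comment> \<open>The image of \<open>W\<close> is a subspace of the coordinate plane of the same
    dimension, so every \<open>p x\<close> is the projection of a point of \<open>W\<close>.\<close>
  have "p ` W = {x. \<forall>i. i \<notin> I \<longrightarrow> x $ i = 0}"
  proof (rule subspace_dim_equal)
    have "dim (p ` W) = dim W"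
      using inj W(1) by (intro dim_image_eq[OF p]) (simp add: span_eq_iff[THEN iffD2])
    then show "dim {x :: real^'n. \<forall>i. i \<notin> I \<longrightarrow> x $ i = 0} \<le> dim (p ` W)"
      using W(2) dim_substandard_cart[of I, where 'a = real] by (simp add: dim_vec_eq)
    show "subspace (p ` W)" using p W(1) by (rule linear_subspace_image)
    show "subspace {x :: real^'n. \<forall>i. i \<notin> I \<longrightarrow> x $ i = 0}" by (auto simp: subspace_def)
  qed (auto simp: p_def)
  then have px: "p x \<in> p ` W" for x by (simp add: p_def)
  have pgp: "p (g (p x)) = p x" for x
  proof -
    obtain w where "w \<in> W" "p x = p w" using px[of x] by blast
    then show ?thesis using g(3) by simp
  qed
  note lin = linear_diff[OF p] linear_add[OF p] linear_diff[OF g(2)] linear_add[OF g(2)]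
  show ?thesis
  proof (rule that[of "\<lambda>x. x - g (p x) + p x" "\<lambda>y. y - p y + g (p y)"])
    show "linear (\<lambda>x. x - g (p x) + p x)" "linear (\<lambda>y. y - p y + g (p y))"
      using linear_compose[OF p g(2)] p
      by (auto intro!: linear_compose_add linear_compose_sub linear_ident simp: o_def)
    fix x
    show "(x - g (p x) + p x) - p (x - g (p x) + p x) + g (p (x - g (p x) + p x)) = x"
      by (simp add: lin pp pgp)
    show "(x - p x + g (p x)) - g (p (x - p x + g (p x))) + p (x - p x + g (p x)) = x"
      by (simp add: lin pp pgp)
    show "(x - g (p x) + p x) $ i = x $ i" if "i \<in> I" for i
    proof -
      have "g (p x) $ i = x $ i"
        using arg_cong[OF pgp[of x], of "\<lambda>v. v $ i"] that by (simp add: pI)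
      then show ?thesis using that by (simp add: pI)
    qed
    show "x \<in> W \<longleftrightarrow> (\<forall>j. j \<notin> I \<longrightarrow> (x - g (p x) + p x) $ j = 0)"
    proof
      assume "x \<in> W"
      then show "\<forall>j. j \<notin> I \<longrightarrow> (x - g (p x) + p x) $ j = 0" using g(3) by (simp add: p_def)
    next
      assume *: "\<forall>j. j \<notin> I \<longrightarrow> (x - g (p x) + p x) $ j = 0"
      then have "p (x - g (p x) + p x) = x - g (p x) + p x"
        by (rule p_id)
      then have "x = g (p x)" by (simp add: lin pp pgp)
      then show "x \<in> W" using g(1) by (metis rangeI subsetD)
    qed
  next
    fix j assume "j \<notin> I"
    then have "p (axis j 1) = 0" by (auto simp: p_def vec_eq_iff axis_def)
    then show "axis j 1 - g (p (axis j 1)) + p (axis j 1) = axis j 1"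
      using linear_0[OF g(2)] by simp
  qed
qed

text \<open>The coordinates \<open>\<phi>\<close> turn the test sets below into boxes, so that only boxes and translations
  have to be measured: the library computes the measure of a general linear image only for
  well-ordered index types, and \<open>'d\<close> is merely of class \<open>{finite, linorder}\<close>.\<close>

locale adapted_coordinates = lattice_basis \<Lambda> B B'
  for \<Lambda> :: "(real^'n) set" and B B' +
  fixes W :: "(real^'n) set" and I :: "'n set" and \<phi> \<psi> :: "real^'n \<Rightarrow> real^'n"
  assumes lin\<phi>: "linear \<phi>" and lin\<psi>: "linear \<psi>"
    and \<psi>\<phi> [simp]: "\<psi> (\<phi> x) = x" and \<phi>\<psi> [simp]: "\<phi> (\<psi> y) = y"
    and \<phi>_I: "i \<in> I \<Longrightarrow> \<phi> x $ i = x $ i"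
    and mem_W: "x \<in> W \<longleftrightarrow> (\<forall>j. j \<notin> I \<longrightarrow> \<phi> x $ j = 0)"
    and \<phi>_axis: "j \<notin> I \<Longrightarrow> \<phi> (axis j 1) = axis j 1"
begin

text \<open>On \<open>W\<close> the \<open>I\<close>-coordinates control the norm, because
  \<open>\<phi> v\<close> vanishes elsewhere; discreteness of \<Lambda> does the rest.\<close>

lemma separation:
  obtains \<delta> where "\<delta> > 0"
    "\<And>v. v \<in> \<Lambda> \<Longrightarrow> v \<in> W \<Longrightarrow> (\<And>i. i \<in> I \<Longrightarrow> \<bar>\<phi> v $ i\<bar> < \<delta>) \<Longrightarrow> v = 0"
proof -
  obtain \<eta> where \<eta>: "\<eta> > 0" "\<And>v. v \<in> \<Lambda> \<Longrightarrow> norm v < \<eta> \<Longrightarrow> v = 0"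
    using discrete by blast
  obtain K where K: "K > 0" "\<And>x. norm (\<psi> x) \<le> K * norm x"
    using linear_bounded_pos[OF lin\<psi>] by blast
  let ?d = "real CARD('n)"
  show ?thesis
  proof
    \<comment> \<open>Summing d coordinates and applying \<open>\<psi>\<close> turns this threshold
      into a norm of at most \<open>\<eta> / 2\<close>, and the half gives strictness.\<close>
    show "\<eta> / (2 * K * ?d) > 0" using \<eta> K by simp
    fix v assume v: "v \<in> \<Lambda>" "v \<in> W" "\<And>i. i \<in> I \<Longrightarrow> \<bar>\<phi> v $ i\<bar> < \<eta> / (2 * K * ?d)"
    have le: "\<bar>\<phi> v $ i\<bar> \<le> \<eta> / (2 * K * ?d)" for i
      using v(3)[of i] v(2) mem_W \<open>\<eta> / (2 * K * ?d) > 0\<close> by (cases "i \<in> I") auto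
    have "norm v \<le> K * norm (\<phi> v)" using K(2)[of "\<phi> v"] by simp
    also have "\<dots> \<le> K * (\<Sum>i\<in>UNIV. \<bar>\<phi> v $ i\<bar>)"
      using K(1) by (intro mult_left_mono norm_le_l1_cart) simp
    also have "\<dots> \<le> K * (\<Sum>i\<in>(UNIV :: 'n set). \<eta> / (2 * K * ?d))"
      using K(1) by (intro mult_left_mono sum_mono le) simp
    also have "\<dots> = \<eta> / 2" using K(1) by simp
    finally show "v = 0" using v(1) \<eta> by auto
  qed
qed

text \<open>A ball covers the space modulo the image of \<Lambda> under \<open>\<phi>\<close>, so
  its volume bounds every set that injects into the quotient.\<close>

lemma covolume_bound:
  obtains V where "\<And>S. S \<in> sets borel \<Longrightarrow> (\<And>x y. x \<in> S \<Longrightarrow> y \<in> S \<Longrightarrow> \<psi> (x - y) \<in> \<Lambda> \<Longrightarrow> x = y)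
      \<Longrightarrow> emeasure lborel S \<le> ennreal V"
proof -
  obtain R where R: "\<And>x. \<exists>l\<in>\<Lambda>. norm (x - l) \<le> R"
    using cobounded by blast
  obtain K where K: "K > 0" "\<And>x. norm (\<phi> x) \<le> K * norm x"
    using linear_bounded_pos[OF lin\<phi>] by blast
  let ?F = "cball 0 (K * R) :: (real^'n) set"
  have "emeasure lborel ?F = ennreal (measure lborel ?F)"
    using emeasure_bounded_finite[of ?F] by (simp add: emeasure_eq_ennreal_measure less_top)
  show ?thesis
  proof (rule that[of "measure lborel ?F"])
    fix S assume S: "S \<in> sets borel" "\<And>x y. x \<in> S \<Longrightarrow> y \<in> S \<Longrightarrow> \<psi> (x - y) \<in> \<Lambda> \<Longrightarrow> x = y"
    have "emeasure lborel S \<le> emeasure lborel ?F"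
    proof (rule packing_le_covering)
      show "countable (\<phi> ` \<Lambda>)" using countable by simp
      show "0 \<in> \<phi> ` \<Lambda>" using zero_mem linear_0[OF lin\<phi>] by force
      show "x - y \<in> \<phi> ` \<Lambda>" if "x \<in> \<phi> ` \<Lambda>" "y \<in> \<phi> ` \<Lambda>" for x y
        using that diff_mem linear_diff[OF lin\<phi>] by (auto simp flip: linear_diff[OF lin\<phi>])
      show "\<exists>l\<in>\<phi> ` \<Lambda>. x - l \<in> ?F" for x
      proof -
        obtain l where l: "l \<in> \<Lambda>" "norm (\<psi> x - l) \<le> R" using R by blast
        have "x - \<phi> l = \<phi> (\<psi> x - l)" by (simp add: linear_diff[OF lin\<phi>])
        then have "norm (x - \<phi> l) \<le> K * norm (\<psi> x - l)" using K(2) by simp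
        also have "\<dots> \<le> K * R" using K(1) l(2) by simp
        finally show ?thesis using l(1) by (intro bexI[of _ "\<phi> l"]) auto
      qed
      show "x = y" if "x \<in> S" "y \<in> S" "x - y \<in> \<phi> ` \<Lambda>" for x y
        using that S(2) by auto
    qed (use S in auto)
    then show "emeasure lborel S \<le> ennreal (measure lborel ?F)"
      using \<open>emeasure lborel ?F = _\<close> by simp
  qed
qed

lemma transversal: "x \<in> W \<Longrightarrow> (\<And>i. i \<in> I \<Longrightarrow> x $ i = 0) \<Longrightarrow> x = 0"
proof -
  assume "x \<in> W" "\<And>i. i \<in> I \<Longrightarrow> x $ i = 0"
  then have "\<phi> x = 0" using mem_W \<phi>_I by (metis vec_eq_iff zero_index)
  then show "x = 0" using \<psi>\<phi>[of x] linear_0[OF lin\<psi>] by simp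
qed

lemma subspace_W: "subspace W"
  using linear_0[OF lin\<phi>] by (auto simp: subspace_def mem_W linear_add[OF lin\<phi>] linear_scale[OF lin\<phi>])

text \<open>\<open>\<sigma>\<close> is the coefficient map of a basis made of vectors of
  \<open>G\<close> and the unit vectors outside \<open>I\<close>. As \<open>\<phi>\<close> maps
  \<open>W\<close> to the \<open>I\<close>-plane and fixes those unit vectors, the coefficients
  outside \<open>I\<close> are coordinates of \<open>\<phi>\<close>, whichever vectors of
  \<open>G\<close> are picked.\<close>

lemma complemented_basis:
  assumes G: "span G = W" and dim: "dim W = card I"
  obtains f \<sigma> where "\<And>i. i \<in> I \<Longrightarrow> f i \<in> G" "\<And>j. j \<notin> I \<Longrightarrow> f j = axis j 1"
    "linear \<sigma>" "\<And>x. x = (\<Sum>l\<in>UNIV. \<sigma> x $ l *\<^sub>R f l)" "\<And>c. \<sigma> (\<Sum>l\<in>UNIV. c l *\<^sub>R f l) = (\<chi> l. c l)"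
    "\<And>x j. j \<notin> I \<Longrightarrow> \<sigma> x $ j = \<phi> x $ j"
proof -
  obtain S where S: "S \<subseteq> G" "independent S" "card S = card I"
  proof -
    obtain S where S: "S \<subseteq> G" "independent S" "G \<subseteq> span S" "card S = dim G"
      using basis_exists by blast
    moreover have "dim G = card I" using G dim by (metis dim_span)
    ultimately show ?thesis using that by simp
  qed
  have finS: "finite S" using S(2) by (rule independent_imp_finite)
  then obtain h where h: "bij_betw h I S"
    using finite_same_card_bij[of I S] S(3) by auto
  define f where "f l = (if l \<in> I then h l else axis l 1)" for l
  define M where "M = (\<chi> r c. f c $ r)"
  have M: "M *v y = (\<Sum>l\<in>UNIV. y $ l *\<^sub>R f l)" for y
    by (simp add: vec_eq_iff M_def matrix_vector_mult_def mult.commute)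
  have fG: "f i \<in> G" if "i \<in> I" for i
    using that h S(1) by (auto simp: f_def bij_betw_def)
  have fW: "f i \<in> W" if "i \<in> I" for i
    using fG[OF that] G span_base by blast
  have split: "(\<Sum>l\<in>UNIV. F l) = (\<Sum>l\<in>I. F l) + (\<Sum>l\<in>-I. F l)" for F :: "'n \<Rightarrow> 'b::comm_monoid_add"
    using sum.union_disjoint[of I "-I" F] by (simp add: Compl_partition)
  \<comment> \<open>The unit-vector part has no \<open>I\<close>-coordinates, so transversality
    kills the part in \<open>W\<close>. Independence then gives the coefficients on
    \<open>I\<close>, and the others are read off coordinatewise.\<close>
  have inj: "y = 0" if y: "M *v y = 0" for y
  proof -
    have sum0: "(\<Sum>l\<in>I. y $ l *\<^sub>R f l) + (\<Sum>l\<in>-I. y $ l *\<^sub>R f l) = 0"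
      using y unfolding M split .
    have "(\<Sum>l\<in>I. y $ l *\<^sub>R f l) = 0"
    proof (rule transversal)
      show "(\<Sum>l\<in>I. y $ l *\<^sub>R f l) \<in> W"
        using fW subspace_W by (intro subspace_sum subspace_scale) auto
      fix i assume i: "i \<in> I"
      have "(\<Sum>l\<in>-I. y $ l *\<^sub>R f l) $ i = 0"
        using i by (auto simp: f_def axis_def intro!: sum.neutral)
      then show "(\<Sum>l\<in>I. y $ l *\<^sub>R f l) $ i = 0"
        using arg_cong[OF sum0, of "\<lambda>v. v $ i"] by (simp only: vector_add_component zero_index)
    qed
    moreover have "(\<Sum>l\<in>I. y $ l *\<^sub>R f l) = (\<Sum>v\<in>S. y $ (inv_into I h v) *\<^sub>R v)"
      using h by (subst sum.reindex_bij_betw[OF h, symmetric])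
        (auto simp: f_def bij_betw_def intro!: sum.cong)
    ultimately have "y $ (inv_into I h v) = 0" if "v \<in> S" for v
      using independentD[OF S(2) finS subset_refl, of "\<lambda>v. y $ (inv_into I h v)"] that by simp
    then have yI: "y $ l = 0" if "l \<in> I" for l
      using that h by (metis bij_betw_def bij_betw_apply inv_into_f_f)
    have "y $ j = 0" if j: "j \<notin> I" for j
    proof -
      have "(M *v y) $ j = (\<Sum>l\<in>UNIV. if l = j then y $ l else 0)"
        unfolding M sum_component by (intro sum.cong) (auto simp: yI f_def axis_def j)
      then show ?thesis using y by simp
    qed
    with yI show ?thesis by (metis vec_eq_iff zero_index)
  qed
  then have "inj ((*v) M)"
    by (simp add: inj_on_def) (metis eq_iff_diff_eq_0 matrix_vector_mult_diff_distrib)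
  then obtain M' where M': "M' ** M = mat 1"
    using matrix_left_invertible_injective by blast
  then have MM': "M ** M' = mat 1" using matrix_left_right_inverse by blast
  have comb: "M' *v (\<Sum>l\<in>UNIV. c l *\<^sub>R f l) = (\<chi> l. c l)" for c
  proof -
    have "M' *v (M *v (\<chi> l. c l)) = (\<chi> l. c l)" by (simp add: matrix_vector_mul_assoc M')
    then show ?thesis by (simp add: M)
  qed
  have expand: "x = (\<Sum>l\<in>UNIV. (M' *v x) $ l *\<^sub>R f l)" for x
    unfolding M[symmetric] by (simp add: matrix_vector_mul_assoc MM')
  have "(M' *v x) $ j = \<phi> x $ j" if j: "j \<notin> I" for x j
  proof -
    have "\<phi> x = (\<Sum>l\<in>UNIV. (M' *v x) $ l *\<^sub>R \<phi> (f l))"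
      by (subst expand) (simp add: linear_sum[OF lin\<phi>] linear_scale[OF lin\<phi>])
    then have "\<phi> x $ j = (\<Sum>l\<in>UNIV. (M' *v x) $ l * \<phi> (f l) $ j)"
      by (simp add: sum_component)
    also have "\<dots> = (\<Sum>l\<in>UNIV. if l = j then (M' *v x) $ l else 0)"
    proof (intro sum.cong refl)
      fix l show "(M' *v x) $ l * \<phi> (f l) $ j = (if l = j then (M' *v x) $ l else 0)"
        using fW[of l] mem_W j \<phi>_axis[of l] by (cases "l \<in> I") (auto simp: f_def axis_def)
    qed
    finally show ?thesis by simp
  qed
  then show ?thesis
    by (intro that[of f "(*v) M'"] fG expand comb) (auto simp: f_def)
qed

end

subsection \<open>Bounds on the expansion\<close>

text \<open>In the application \<open>\<beta> i\<close> is the \<open>i\<close>-th diagonal entry of \<open>a\<^sub>t\<close> and \<open>\<kappa>\<close> is \<open>\<lambda>\<^sub>k\<close> at time \<open>t\<close>.\<close>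

locale short_basis = adapted_coordinates \<Lambda> B B' W I \<phi> \<psi>
  for \<Lambda> :: "(real^'n) set" and B B' W I \<phi> \<psi> +
  fixes f :: "'n \<Rightarrow> real^'n" and \<sigma> :: "real^'n \<Rightarrow> real^'n" and \<beta> :: "'n \<Rightarrow> real" and \<kappa> :: real
  assumes f_\<Lambda>: "l \<in> I \<Longrightarrow> f l \<in> \<Lambda>"
    and f_short: "l \<in> I \<Longrightarrow> \<beta> i * \<bar>f l $ i\<bar> \<le> \<kappa> / 2"
    and f_axis: "j \<notin> I \<Longrightarrow> f j = axis j 1"
    and lin\<sigma>: "linear \<sigma>"
    and expand: "x = (\<Sum>l\<in>UNIV. \<sigma> x $ l *\<^sub>R f l)"
    and \<sigma>_comb: "\<sigma> (\<Sum>l\<in>UNIV. c l *\<^sub>R f l) = (\<chi> l. c l)"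
    and \<sigma>_\<phi>: "j \<notin> I \<Longrightarrow> \<sigma> x $ j = \<phi> x $ j"
    and \<beta>_pos: "\<beta> i > 0" and \<beta>_prod: "(\<Prod>i\<in>UNIV. \<beta> i) = 1" and \<kappa>_pos: "\<kappa> > 0"
    and short_W: "\<lbrakk>v \<in> \<Lambda>; \<And>i. \<beta> i * \<bar>v $ i\<bar> \<le> \<kappa> / 2\<rbrakk> \<Longrightarrow> v \<in> W"
begin

section \<open>Combinations of short vectors and the volume of the test boxes\<close>

lemma comb_component:
  "(\<Sum>l\<in>UNIV. c l *\<^sub>R f l) $ i = (\<Sum>l\<in>I. c l * f l $ i) + (if i \<in> I then 0 else c i)"
proof -
  have "(\<Sum>l\<in>UNIV. c l *\<^sub>R f l) $ i = (\<Sum>l\<in>I. c l * f l $ i) + (\<Sum>l\<in>-I. c l * f l $ i)"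
    using sum.union_disjoint[of I "-I" "\<lambda>l. c l * f l $ i"] by (simp add: Compl_partition)
  moreover have "(\<Sum>l\<in>-I. c l * f l $ i) = (\<Sum>l\<in>-I. if l = i then c l else 0)"
    by (intro sum.cong) (auto simp: f_axis axis_def)
  ultimately show ?thesis by (simp add: sum.delta)
qed

lemma comb_short:
  assumes "\<And>l. l \<in> I \<Longrightarrow> \<bar>c l\<bar> \<le> a"
  shows "\<beta> i * \<bar>\<Sum>l\<in>I. c l * f l $ i\<bar> \<le> card I * (a * (\<kappa> / 2))"
proof -
  have "\<beta> i * \<bar>\<Sum>l\<in>I. c l * f l $ i\<bar> \<le> \<beta> i * (\<Sum>l\<in>I. \<bar>c l * f l $ i\<bar>)"
    using \<beta>_pos[of i] by (intro mult_left_mono sum_abs) simp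
  also have "\<dots> = (\<Sum>l\<in>I. \<bar>c l\<bar> * (\<beta> i * \<bar>f l $ i\<bar>))"
    by (simp add: sum_distrib_left abs_mult mult_ac)
  also have "\<dots> \<le> (\<Sum>l\<in>I. a * (\<kappa> / 2))"
    using assms f_short \<beta>_pos[of i] by (intro sum_mono mult_mono) (auto intro: order_trans[OF abs_ge_zero])
  finally show ?thesis by simp
qed

text \<open>Determinant 1: expansion on \<open>I\<close> is balanced by contraction on the
  complement.\<close>

lemma prod_I: "(\<Prod>j\<in>-I. 1 / \<beta> j) = (\<Prod>i\<in>I. \<beta> i)"
proof -
  have "(\<Prod>j\<in>-I. 1 / \<beta> j) = 1 / (\<Prod>j\<in>-I. \<beta> j)"
    by (simp add: prod_dividef)
  also have "\<dots> = (\<Prod>i\<in>I. \<beta> i) * (\<Prod>j\<in>-I. \<beta> j) / (\<Prod>j\<in>-I. \<beta> j)"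
    using prod.union_disjoint[of I "-I" \<beta>] \<beta>_prod by (simp add: Compl_partition)
  also have "\<dots> = (\<Prod>i\<in>I. \<beta> i)"
    using prod_pos[of "-I" \<beta>] \<beta>_pos by (metis less_irrefl nonzero_mult_div_cancel_right)
  finally show ?thesis .
qed

text \<open>A box in the coordinates \<open>\<phi>\<close>. The sides \<open>\<delta>\<close> make
  \<open>separation\<close> applicable to differences of its points, and the sides
  \<open>\<rho> / \<beta> i\<close> keep their other coordinates below \<open>\<rho>\<close> after
  rescaling.\<close>

definition test_box :: "real \<Rightarrow> real \<Rightarrow> (real^'n) set" where
  "test_box \<delta> \<rho> = box 0 (\<chi> i. if i \<in> I then \<delta> else \<rho> / \<beta> i)"

lemma mem_test_box:
  "y \<in> test_box \<delta> \<rho> \<longleftrightarrow> (\<forall>i. 0 < y $ i \<and> y $ i < (if i \<in> I then \<delta> else \<rho> / \<beta> i))"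
  by (simp add: test_box_def mem_box_cart)

lemma emeasure_test_box:
  assumes "\<delta> > 0" "\<rho> > 0"
  shows "emeasure lborel (test_box \<delta> \<rho>) = ennreal (\<delta> ^ card I * \<rho> ^ card (- I) * (\<Prod>i\<in>I. \<beta> i))"
proof -
  let ?b = "\<lambda>i. if i \<in> I then \<delta> else \<rho> / \<beta> i"
  have "(\<Prod>i\<in>UNIV. ?b i) = (\<Prod>i\<in>I. ?b i) * (\<Prod>i\<in>-I. ?b i)"
    using prod.union_disjoint[of I "-I" ?b] by (simp add: Compl_partition)
  also have "(\<Prod>i\<in>I. ?b i) = \<delta> ^ card I" by simp
  also have "(\<Prod>i\<in>-I. ?b i) = (\<Prod>i\<in>-I. \<rho> * (1 / \<beta> i))" by (intro prod.cong) auto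
  also have "\<dots> = \<rho> ^ card (-I) * (\<Prod>i\<in>I. \<beta> i)" by (simp only: prod.distrib prod_I prod_constant)
  finally have "(\<Prod>i\<in>UNIV. ?b i) = \<delta> ^ card I * \<rho> ^ card (-I) * (\<Prod>i\<in>I. \<beta> i)" by simp
  moreover have "0 \<le> ?b i" for i using assms \<beta>_pos[of i] by simp
  ultimately show ?thesis
    unfolding test_box_def by (subst emeasure_lborel_box_cart) auto
qed

text \<open>Packing argument for the lattice spanned by \<open>\<phi> (f l)\<close> (\<open>l \<in> I\<close>) and the rescaled unit vectors
  \<open>e\<^sub>j / \<beta> j\<close> (\<open>j \<notin> I\<close>).\<close>

lemma \<kappa>_lower_bound:
  assumes \<delta>: "\<delta> > 0"
    and sep: "\<And>v. v \<in> \<Lambda> \<Longrightarrow> v \<in> W \<Longrightarrow> (\<And>i. i \<in> I \<Longrightarrow> \<bar>\<phi> v $ i\<bar> < \<delta>) \<Longrightarrow> v = 0"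
  shows "\<delta> ^ card I * (\<Prod>i\<in>I. \<beta> i) \<le> (card I * \<kappa>) ^ card I"
proof -
  define L where "L = {y. (\<forall>l\<in>I. \<sigma> (\<psi> y) $ l \<in> \<int>) \<and> (\<forall>j. j \<notin> I \<longrightarrow> \<beta> j * y $ j \<in> \<int>)}"
  \<comment> \<open>Rounding down leaves a combination of \<open>card I\<close> short vectors with
    coefficients of size at most 1, hence the half-width in the \<open>I\<close>-directions; the
    other coordinates leave a remainder between 0 and \<open>1 / \<beta> i\<close>.\<close>
  define F where "F = cbox (\<chi> i. if i \<in> I then - (card I * \<kappa> / (2 * \<beta> i)) else 0)
    (\<chi> i. if i \<in> I then card I * \<kappa> / (2 * \<beta> i) else 1 / \<beta> i)"
  have "emeasure lborel (test_box \<delta> 1) \<le> emeasure lborel F"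
  proof (rule packing_le_covering)
    have "L \<subseteq> (\<lambda>z. \<phi> (\<Sum>l\<in>UNIV. (z $ l * (if l \<in> I then 1 else 1 / \<beta> l)) *\<^sub>R f l)) ` {z. \<forall>i. z $ i \<in> \<int>}"
    proof
      fix y assume y: "y \<in> L"
      define z where "z = (\<chi> l. if l \<in> I then \<sigma> (\<psi> y) $ l else \<beta> l * y $ l)"
      have "z $ l * (if l \<in> I then 1 else 1 / \<beta> l) = \<sigma> (\<psi> y) $ l" for l
        using \<beta>_pos[of l] by (simp add: z_def \<sigma>_\<phi>)
      then have "\<psi> y = (\<Sum>l\<in>UNIV. (z $ l * (if l \<in> I then 1 else 1 / \<beta> l)) *\<^sub>R f l)"
        using expand[of "\<psi> y"] by simp
      then have "y = \<phi> (\<Sum>l\<in>UNIV. (z $ l * (if l \<in> I then 1 else 1 / \<beta> l)) *\<^sub>R f l)"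
        by (metis \<phi>\<psi>)
      moreover have "\<forall>i. z $ i \<in> \<int>" using y by (simp add: z_def L_def)
      ultimately show "y \<in> (\<lambda>z. \<phi> (\<Sum>l\<in>UNIV. (z $ l * (if l \<in> I then 1 else 1 / \<beta> l)) *\<^sub>R f l)) ` {z. \<forall>i. z $ i \<in> \<int>}"
        by blast
    qed
    then show "countable L"
      by (rule countable_subset) (intro countable_image countable_integer_vectors)
    show "0 \<in> L" by (simp add: L_def linear_0[OF lin\<sigma>] linear_0[OF lin\<psi>])
    show "x - y \<in> L" if "x \<in> L" "y \<in> L" for x y
      using that by (simp add: L_def linear_diff[OF lin\<sigma>] linear_diff[OF lin\<psi>] right_diff_distrib)
    show "test_box \<delta> 1 \<in> sets borel" "F \<in> sets borel" by (simp_all add: test_box_def F_def)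
    show "\<exists>l\<in>L. y - l \<in> F" for y
    proof
      define c where "c l = (if l \<in> I then of_int \<lfloor>\<sigma> (\<psi> y) $ l\<rfloor> else of_int \<lfloor>\<beta> l * y $ l\<rfloor> / \<beta> l)" for l
      define r where "r l = \<sigma> (\<psi> y) $ l - c l" for l
      let ?s = "\<Sum>l\<in>UNIV. c l *\<^sub>R f l"
      have \<phi>s: "\<phi> ?s $ j = c j" if "j \<notin> I" for j
        using \<sigma>_\<phi>[OF that, of ?s] by (simp add: \<sigma>_comb)
      show "\<phi> ?s \<in> L"
        using \<beta>_pos by (simp add: L_def \<sigma>_comb \<phi>s) (simp add: c_def less_imp_neq[THEN not_sym])
      have "\<psi> y - ?s = (\<Sum>l\<in>UNIV. \<sigma> (\<psi> y) $ l *\<^sub>R f l) - ?s"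
        using expand[of "\<psi> y"] by simp
      also have "\<dots> = (\<Sum>l\<in>UNIV. r l *\<^sub>R f l)"
        by (simp add: r_def scaleR_diff_left sum_subtractf)
      finally have y: "y - \<phi> ?s = \<phi> (\<Sum>l\<in>UNIV. r l *\<^sub>R f l)"
        by (metis linear_diff[OF lin\<phi>] \<phi>\<psi>)
      have yI: "(y - \<phi> ?s) $ i = (\<Sum>l\<in>I. r l * f l $ i)" if "i \<in> I" for i
        unfolding y \<phi>_I[OF that] comb_component using that by simp
      have "\<bar>(y - \<phi> ?s) $ i\<bar> \<le> card I * \<kappa> / (2 * \<beta> i)" if i: "i \<in> I" for i
      proof -
        have "\<bar>r l\<bar> \<le> 1" if "l \<in> I" for l using that unfolding r_def c_def by simp linarith
        then have "\<beta> i * \<bar>\<Sum>l\<in>I. r l * f l $ i\<bar> \<le> card I * (1 * (\<kappa> / 2))"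
          by (rule comb_short)
        then show ?thesis using \<beta>_pos[of i] unfolding yI[OF i] by (simp add: field_simps)
      qed
      then have "- (card I * \<kappa> / (2 * \<beta> i)) \<le> (y - \<phi> ?s) $ i" "(y - \<phi> ?s) $ i \<le> card I * \<kappa> / (2 * \<beta> i)"
        if "i \<in> I" for i using that by (meson abs_le_iff minus_le_iff)+
      moreover have "0 \<le> (y - \<phi> ?s) $ j" "(y - \<phi> ?s) $ j \<le> 1 / \<beta> j" if "j \<notin> I" for j
      proof -
        have "(y - \<phi> ?s) $ j = (\<beta> j * y $ j - \<lfloor>\<beta> j * y $ j\<rfloor>) / \<beta> j"
          unfolding vector_minus_component \<phi>s[OF that]
          using \<beta>_pos[of j] that by (simp add: c_def field_simps)
        moreover have "0 \<le> \<beta> j * y $ j - \<lfloor>\<beta> j * y $ j\<rfloor>" "\<beta> j * y $ j - \<lfloor>\<beta> j * y $ j\<rfloor> \<le> 1"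
          by linarith+
        ultimately show "0 \<le> (y - \<phi> ?s) $ j" "(y - \<phi> ?s) $ j \<le> 1 / \<beta> j"
          using \<beta>_pos[of j] by (simp_all add: divide_right_mono)
      qed
      ultimately show "y - \<phi> ?s \<in> F"
        unfolding F_def mem_box_cart by simp
    qed
    show "x = y" if xy: "x \<in> test_box \<delta> 1" "y \<in> test_box \<delta> 1" "x - y \<in> L" for x y
    proof -
      \<comment> \<open>Outside \<open>I\<close> the difference vanishes by integrality. So
        \<open>v\<close> is an integer combination of the \<open>f l\<close> with
        \<open>l \<in> I\<close>, hence in \<Lambda> and in \<open>W\<close>, and \<open>sep\<close>
        applies.\<close>
      define v where "v = \<psi> (x - y)"
      have box: "0 < x $ i" "x $ i < (if i \<in> I then \<delta> else 1 / \<beta> i)"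
        "0 < y $ i" "y $ i < (if i \<in> I then \<delta> else 1 / \<beta> i)" for i
        using xy(1,2) unfolding mem_test_box by blast+
      have xj: "(x - y) $ j = 0" if j: "j \<notin> I" for j
      proof -
        have "\<bar>x $ j - y $ j\<bar> < 1 / \<beta> j" using box[of j] j by simp
        then have "\<beta> j * \<bar>x $ j - y $ j\<bar> < 1" using \<beta>_pos[of j] by (simp add: field_simps)
        then have "\<bar>\<beta> j * (x - y) $ j\<bar> < 1"
          using \<beta>_pos[of j] by (simp only: abs_mult abs_of_pos vector_minus_component)
        moreover have "\<beta> j * (x - y) $ j \<in> \<int>" using xy(3) j by (simp add: L_def)
        ultimately have "\<beta> j * (x - y) $ j = 0" using Ints_nonzero_abs_less1 by blast
        then show ?thesis using \<beta>_pos[of j] by simp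
      qed
      have "\<sigma> v $ l *\<^sub>R f l \<in> \<Lambda>" for l
      proof (cases "l \<in> I")
        case True
        then show ?thesis using xy(3) by (intro scale_mem f_\<Lambda>) (auto simp: v_def L_def)
      next
        case False
        then show ?thesis using xj by (simp add: \<sigma>_\<phi> v_def zero_mem)
      qed
      then have "(\<Sum>l\<in>UNIV. \<sigma> v $ l *\<^sub>R f l) \<in> \<Lambda>" by (intro sum_mem)
      then have "v \<in> \<Lambda>" using expand[of v] by simp
      moreover have "v \<in> W" using xj by (simp add: mem_W v_def)
      moreover have "\<bar>\<phi> v $ i\<bar> < \<delta>" if i: "i \<in> I" for i
        using box[of i] i by (simp add: v_def)
      ultimately have "v = 0" by (rule sep)
      then have "x - y = 0" using linear_0[OF lin\<phi>] \<phi>\<psi>[of "x - y"] by (simp add: v_def)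
      then show "x = y" by simp
    qed
  qed
  \<comment> \<open>The \<open>\<beta> i\<close> cancel: the \<open>I\<close>-sides contribute the
    inverse of their product over \<open>I\<close>, the remaining sides that product itself.\<close>
  also have "emeasure lborel F = ennreal ((card I * \<kappa>) ^ card I)"
  proof -
    let ?g = "\<lambda>i. if i \<in> I then card I * \<kappa> * (1 / \<beta> i) else 1 / \<beta> i"
    have "(\<Prod>i\<in>UNIV. ?g i) = (\<Prod>i\<in>I. ?g i) * (\<Prod>i\<in>-I. ?g i)"
      using prod.union_disjoint[of I "-I" ?g] by (simp add: Compl_partition)
    also have "(\<Prod>i\<in>I. ?g i) = (card I * \<kappa>) ^ card I * (\<Prod>i\<in>I. 1 / \<beta> i)"
      by (simp only: if_True prod.distrib prod_constant power_mult_distrib cong: prod.cong)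
    also have "(\<Prod>i\<in>-I. ?g i) = (\<Prod>i\<in>-I. 1 / \<beta> i)" by (intro prod.cong) auto
    also have "\<dots> = (\<Prod>i\<in>I. \<beta> i)" by (rule prod_I)
    also have "(card I * \<kappa>) ^ card I * (\<Prod>i\<in>I. 1 / \<beta> i) * (\<Prod>i\<in>I. \<beta> i) = (card I * \<kappa>) ^ card I * (\<Prod>i\<in>I. 1 / \<beta> i * \<beta> i)"
      by (simp only: prod.distrib mult.assoc)
    also have "(\<Prod>i\<in>I. 1 / \<beta> i * \<beta> i) = 1"
      using \<beta>_pos by (intro prod.neutral) (simp add: less_imp_neq[THEN not_sym])
    finally have g: "(\<Prod>i\<in>UNIV. ?g i) = (card I * \<kappa>) ^ card I" by simp
    have nonneg: "0 \<le> card I * \<kappa> / (2 * \<beta> i)" "0 \<le> 1 / \<beta> i" for i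
      using \<beta>_pos[of i] \<kappa>_pos by auto
    show ?thesis
      unfolding F_def g[symmetric] using nonneg
      by (subst emeasure_lborel_box_cart)
         (auto intro!: arg_cong[where f = ennreal] prod.cong order_trans[OF _ nonneg(1)] simp: field_simps)
  qed
  finally show ?thesis
    using \<kappa>_pos by (simp add: emeasure_test_box[OF \<delta>])
qed

text \<open>The test box is cut into \<open>N\<^sup>k\<close> cells, \<open>N = 2k\<close>, according to the fractional parts of the
  coefficients \<open>\<sigma>\<close>. If two points of a cell differ by a lattice vector, then subtracting integer
  multiples of the \<open>f l\<close> makes that vector short, so it lies in \<open>W\<close> and the two points agree.\<close>

lemma product_upper_bound:
  fixes \<delta> \<rho> V :: real
  assumes \<delta>: "\<delta> > 0" and \<rho>: "\<rho> > 0" "4 * \<rho> \<le> \<kappa>" and I: "I \<noteq> {}"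
    and sep: "\<And>v. v \<in> \<Lambda> \<Longrightarrow> v \<in> W \<Longrightarrow> (\<And>i. i \<in> I \<Longrightarrow> \<bar>\<phi> v $ i\<bar> < \<delta>) \<Longrightarrow> v = 0"
    and V: "V \<ge> 0" "\<And>S. S \<in> sets borel \<Longrightarrow>
      (\<And>x y. x \<in> S \<Longrightarrow> y \<in> S \<Longrightarrow> \<psi> (x - y) \<in> \<Lambda> \<Longrightarrow> x = y) \<Longrightarrow> emeasure lborel S \<le> ennreal V"
  shows "\<delta> ^ card I * \<rho> ^ card (- I) * (\<Prod>i\<in>I. \<beta> i) \<le> (2 * card I) ^ card I * V"
proof -
  \<comment> \<open>With this \<open>N\<close> the short vectors contribute at most card I * (1 / N)
    * (\<kappa> / 2) = \<kappa> / 4; the assumption \<open>4 * \<rho> \<le> \<kappa>\<close>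
    provides the other quarter of the admissible \<kappa> / 2.\<close>
  define N where "N = 2 * int (card I)"
  have k: "card I > 0" using I by (simp add: card_gt_0_iff)
  then have N: "N > 0" by (simp add: N_def)
  \<comment> \<open>\<open>q y l mod N\<close> tells which of the \<open>N\<close> equal parts of
    the unit interval contains the fractional part of the coefficient.\<close>
  define q where "q y l = \<lfloor>N * \<sigma> (\<psi> y) $ l\<rfloor>" for y l
  define Cells where "Cells = PiE I (\<lambda>_. {0..<N})"
  define D where "D c = test_box \<delta> \<rho> \<inter> (\<Inter>l\<in>I. {y. q y l mod N = c l})" for c
  have finC: "finite Cells" by (simp add: Cells_def finite_PiE)
  have cont: "continuous_on UNIV (\<lambda>y. N * \<sigma> (\<psi> y) $ l)" for l
    using linear_continuous_on[OF linear_conv_bounded_linear[THEN iffD1, OF linear_compose[OF lin\<psi> lin\<sigma>]]]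
    by (intro continuous_intros) (simp add: o_def)
  have D_borel: "D c \<in> sets borel" for c
  proof -
    have "{y. q y l mod N = c l} \<in> sets borel" for l
    proof -
      have "(\<lambda>y. N * \<sigma> (\<psi> y) $ l) \<in> borel_measurable borel"
        using cont by (rule borel_measurable_continuous_onI)
      then have "{y \<in> space borel. q y l mod N = c l} \<in> sets borel"
        unfolding q_def by measurable
      then show ?thesis by simp
    qed
    then show ?thesis
      using I unfolding D_def by (intro sets.Int sets.finite_INT) (auto simp: test_box_def)
  qed
  have D_small: "emeasure lborel (D c) \<le> ennreal V" for c
  proof (rule V(2)[OF D_borel])
    fix x y assume xy: "x \<in> D c" "y \<in> D c" and v\<Lambda>: "\<psi> (x - y) \<in> \<Lambda>"
    define v where "v = \<psi> (x - y)"
    \<comment> \<open>Equal residues make this division exact, so the coefficient of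
      \<open>v\<close> is within \<open>1 / N\<close> of the integer \<open>n l\<close>.\<close>
    define n where "n l = real_of_int ((q x l - q y l) div N)" for l
    define e where "e l = (if l \<in> I then \<sigma> v $ l - n l else \<sigma> v $ l)" for l
    have box: "0 < x $ i" "x $ i < (if i \<in> I then \<delta> else \<rho> / \<beta> i)"
      "0 < y $ i" "y $ i < (if i \<in> I then \<delta> else \<rho> / \<beta> i)" for i
      using xy unfolding D_def Int_iff mem_test_box by blast+
    have e_I: "\<bar>e l\<bar> \<le> 1 / N" if l: "l \<in> I" for l
    proof -
      have "q x l mod N = q y l mod N" using xy l by (auto simp: D_def)
      then have "N dvd q x l - q y l" by (rule mod_eq_dvd_iff[THEN iffD1])
      then have "N * n l = q x l - q y l"
        unfolding n_def by (simp flip: of_int_mult of_int_diff)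
      moreover have "\<sigma> v $ l = \<sigma> (\<psi> x) $ l - \<sigma> (\<psi> y) $ l"
        by (simp add: v_def linear_diff[OF lin\<psi>] linear_diff[OF lin\<sigma>])
      ultimately have "N * e l = (N * \<sigma> (\<psi> x) $ l - q x l) - (N * \<sigma> (\<psi> y) $ l - q y l)"
        using l by (simp add: e_def right_diff_distrib)
      moreover have "\<bar>(N * \<sigma> (\<psi> x) $ l - q x l) - (N * \<sigma> (\<psi> y) $ l - q y l)\<bar> \<le> 1"
        unfolding q_def by linarith
      ultimately have "N * \<bar>e l\<bar> \<le> 1" using N by (metis abs_mult abs_of_pos of_int_0_less_iff)
      then show ?thesis using N by (simp add: field_simps)
    qed
    have e_J: "e j = (x - y) $ j" if "j \<notin> I" for j
      using that by (simp add: e_def \<sigma>_\<phi> v_def)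
    let ?z = "\<Sum>l\<in>UNIV. e l *\<^sub>R f l"
    have "?z = (\<Sum>l\<in>UNIV. \<sigma> v $ l *\<^sub>R f l) - (\<Sum>l\<in>UNIV. (if l \<in> I then n l else 0) *\<^sub>R f l)"
      unfolding sum_subtractf[symmetric] by (intro sum.cong) (auto simp: e_def scaleR_diff_left)
    also have "\<dots> = v - (\<Sum>l\<in>UNIV. (if l \<in> I then n l else 0) *\<^sub>R f l)"
      using expand[of v] by simp
    also have "\<dots> \<in> \<Lambda>"
    proof (intro diff_mem sum_mem)
      show "v \<in> \<Lambda>" using v\<Lambda> by (simp add: v_def)
      show "(if l \<in> I then n l else 0) *\<^sub>R f l \<in> \<Lambda>" for l
        using f_\<Lambda>[of l] by (auto simp: n_def zero_mem intro!: scale_mem)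
    qed
    finally have z\<Lambda>: "?z \<in> \<Lambda>" .
    have "?z \<in> W"
    proof (rule short_W[OF z\<Lambda>])
      fix i
      have "\<beta> i * \<bar>\<Sum>l\<in>I. e l * f l $ i\<bar> \<le> card I * (1 / N * (\<kappa> / 2))"
        using e_I by (rule comb_short)
      also have "\<dots> = \<kappa> / 4" using k I by (simp add: N_def)
      finally have 1: "\<beta> i * \<bar>\<Sum>l\<in>I. e l * f l $ i\<bar> \<le> \<kappa> / 4" .
      have 2: "\<beta> i * \<bar>if i \<in> I then 0 else e i\<bar> \<le> \<kappa> / 4"
      proof (cases "i \<in> I")
        case False
        then have "\<bar>e i\<bar> \<le> \<rho> / \<beta> i" using box[of i] by (simp add: e_J)
        then have "\<beta> i * \<bar>e i\<bar> \<le> \<rho>" using \<beta>_pos[of i] by (simp add: field_simps)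
        then show ?thesis using False \<rho>(2) by simp
      qed (use \<kappa>_pos in simp)
      have "\<beta> i * \<bar>?z $ i\<bar> \<le> \<beta> i * (\<bar>\<Sum>l\<in>I. e l * f l $ i\<bar> + \<bar>if i \<in> I then 0 else e i\<bar>)"
        unfolding comb_component using \<beta>_pos[of i] by (intro mult_left_mono abs_triangle_ineq) simp
      then show "\<beta> i * \<bar>?z $ i\<bar> \<le> \<kappa> / 2" using 1 2 unfolding distrib_left by linarith
    qed
    \<comment> \<open>Only multiples of \<open>f l\<close> with \<open>l \<in> I\<close> were
      subtracted, so outside \<open>I\<close> the coefficients of \<open>?z\<close> are still those
      of \<open>v\<close>, and \<open>?z \<in> W\<close> makes them 0.\<close>
    have xj: "(x - y) $ j = 0" if j: "j \<notin> I" for j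
    proof -
      have "e j = \<sigma> ?z $ j" by (simp add: \<sigma>_comb)
      also have "\<dots> = 0" using \<open>?z \<in> W\<close> mem_W j by (simp add: \<sigma>_\<phi>)
      finally show ?thesis using e_J[OF j] by simp
    qed
    have "v = 0"
    proof (rule sep)
      show "v \<in> \<Lambda>" using v\<Lambda> by (simp add: v_def)
      show "v \<in> W" using xj by (simp add: mem_W v_def)
      show "\<bar>\<phi> v $ i\<bar> < \<delta>" if "i \<in> I" for i
        using box[of i] that by (simp add: v_def)
    qed
    then have "x - y = 0" using linear_0[OF lin\<phi>] \<phi>\<psi>[of "x - y"] by (simp add: v_def)
    then show "x = y" by simp
  qed
  have "test_box \<delta> \<rho> \<subseteq> (\<Union>c\<in>Cells. D c)"
  proof
    fix y assume "y \<in> test_box \<delta> \<rho>"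
    then have "y \<in> D (restrict (\<lambda>l. q y l mod N) I)" by (simp add: D_def)
    moreover have "restrict (\<lambda>l. q y l mod N) I \<in> Cells" using N by (simp add: Cells_def)
    ultimately show "y \<in> (\<Union>c\<in>Cells. D c)" by blast
  qed
  then have "emeasure lborel (test_box \<delta> \<rho>) \<le> emeasure lborel (\<Union>c\<in>Cells. D c)"
    using D_borel finC by (intro emeasure_mono) auto
  also have "\<dots> \<le> (\<Sum>c\<in>Cells. emeasure lborel (D c))"
    using D_borel finC by (intro emeasure_subadditive_finite) auto
  also have "\<dots> \<le> (\<Sum>c\<in>Cells. ennreal V)"
    by (intro sum_mono D_small)
  also have "\<dots> = ennreal ((2 * card I) ^ card I * V)"
  proof -
    have "card Cells = (2 * card I) ^ card I"
      using N by (simp add: Cells_def card_PiE N_def nat_mult_distrib)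
    moreover have "(\<Sum>c\<in>Cells. ennreal V) = ennreal (\<Sum>c\<in>Cells. V)"
      using V(1) by (intro sum_ennreal)
    ultimately show ?thesis by simp
  qed
  finally show ?thesis
    using V(1) by (simp add: emeasure_test_box[OF \<delta> \<rho>(1)])
qed

end

text \<open>\<open>C\<close> is chosen before \<open>\<beta>\<close> and \<open>r\<close>, hence is
  uniform in time. When the product exceeds 1, \<open>\<kappa>_lower_bound\<close> keeps
  \<open>r\<close> away from 0, which admits a fixed \<open>\<rho>\<close> in
  \<open>product_upper_bound\<close>.\<close>

lemma (in adapted_coordinates) product_bounded:
  assumes dim: "dim W = card I"
  shows "\<exists>C. \<forall>\<beta> r. (\<forall>i. \<beta> i > 0) \<and> (\<Prod>i\<in>UNIV. \<beta> i) = 1 \<and> r > 0 \<and>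
    span {v\<in>\<Lambda>. \<forall>i. \<beta> i * \<bar>v $ i\<bar> \<le> r / 2} = W \<longrightarrow> (\<Prod>i\<in>I. \<beta> i) \<le> C"
proof -
  obtain \<delta> where \<delta>: "\<delta> > 0"
    and sep: "\<And>v. v \<in> \<Lambda> \<Longrightarrow> v \<in> W \<Longrightarrow> (\<And>i. i \<in> I \<Longrightarrow> \<bar>\<phi> v $ i\<bar> < \<delta>) \<Longrightarrow> v = 0"
    using separation by blast
  obtain V' where V': "\<And>S. S \<in> sets borel \<Longrightarrow> (\<And>x y. x \<in> S \<Longrightarrow> y \<in> S \<Longrightarrow> \<psi> (x - y) \<in> \<Lambda> \<Longrightarrow> x = y)
      \<Longrightarrow> emeasure lborel S \<le> ennreal V'"
    using covolume_bound by blast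
  \<comment> \<open>\<open>ennreal\<close> sends negative reals to 0, so the bound survives and the
    sign condition is gained.\<close>
  define V where "V = max 0 V'"
  have V: "emeasure lborel S \<le> ennreal V"
    if "S \<in> sets borel" "\<And>x y. x \<in> S \<Longrightarrow> y \<in> S \<Longrightarrow> \<psi> (x - y) \<in> \<Lambda> \<Longrightarrow> x = y" for S
    using V'[OF that] by (rule order_trans) (simp_all add: V_def ennreal_leI)
  define k where "k = card I"
  \<comment> \<open>The largest value with \<open>4 * \<rho> \<le> r\<close> for every
    \<open>r\<close> satisfying \<open>\<delta> < k * r\<close>.\<close>
  define \<rho> where "\<rho> = \<delta> / (4 * k)"
  \<comment> \<open>The alternative 1 covers products of at most 1, in particular the empty
    product.\<close>
  define C where "C = max 1 ((2 * k) ^ k * V / (\<delta> ^ k * \<rho> ^ card (- I)))"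
  have bound: "(\<Prod>i\<in>I. \<beta> i) \<le> C" if \<beta>: "\<And>i. \<beta> i > 0" "(\<Prod>i\<in>UNIV. \<beta> i) = 1" and r: "r > 0"
    and spn: "span {v\<in>\<Lambda>. \<forall>i. \<beta> i * \<bar>v $ i\<bar> \<le> r / 2} = W" for \<beta> r
  proof (cases "(\<Prod>i\<in>I. \<beta> i) \<le> 1")
    case False
    let ?G = "{v\<in>\<Lambda>. \<forall>i. \<beta> i * \<bar>v $ i\<bar> \<le> r / 2}"
    have I: "I \<noteq> {}" using False by auto
    then have k: "k > 0" by (simp add: k_def card_gt_0_iff)
    have G_W: "v \<in> W" if "v \<in> ?G" for v
      using span_base[OF that] unfolding spn .
    have "\<exists>f \<sigma>. short_basis \<Lambda> B B' W I \<phi> \<psi> f \<sigma> \<beta> r"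
    proof (rule complemented_basis[OF spn dim])
      fix f :: "'n \<Rightarrow> real^'n" and \<sigma> :: "real^'n \<Rightarrow> real^'n"
      assume f: "\<And>i. i \<in> I \<Longrightarrow> f i \<in> ?G"
        and other: "\<And>j. j \<notin> I \<Longrightarrow> f j = axis j 1" "linear \<sigma>" "\<And>x. x = (\<Sum>l\<in>UNIV. \<sigma> x $ l *\<^sub>R f l)"
          "\<And>c. \<sigma> (\<Sum>l\<in>UNIV. c l *\<^sub>R f l) = (\<chi> l. c l)" "\<And>x j. j \<notin> I \<Longrightarrow> \<sigma> x $ j = \<phi> x $ j"
      have "short_basis \<Lambda> B B' W I \<phi> \<psi> f \<sigma> \<beta> r"
      proof (intro short_basis.intro short_basis_axioms.intro)
        show "f l \<in> \<Lambda>" "\<beta> i * \<bar>f l $ i\<bar> \<le> r / 2" if "l \<in> I" for l i using f[OF that] by simp_all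
        show "v \<in> W" if "v \<in> \<Lambda>" "\<And>i. \<beta> i * \<bar>v $ i\<bar> \<le> r / 2" for v
          using that by (intro G_W) simp
      qed (rule adapted_coordinates_axioms other \<beta> r | assumption)+
      then show ?thesis by (intro exI)
    qed
    then obtain f \<sigma> where "short_basis \<Lambda> B B' W I \<phi> \<psi> f \<sigma> \<beta> r" by (elim exE)
    then interpret short_basis \<Lambda> B B' W I \<phi> \<psi> f \<sigma> \<beta> r .
    have "\<delta> ^ k < \<delta> ^ k * (\<Prod>i\<in>I. \<beta> i)" using False \<delta> by simp
    also have "\<dots> \<le> (k * r) ^ k"
      unfolding k_def
    proof (rule \<kappa>_lower_bound[OF \<delta>])
      show "v = 0" if "v \<in> \<Lambda>" "v \<in> W" "\<And>i. i \<in> I \<Longrightarrow> \<bar>\<phi> v $ i\<bar> < \<delta>" for v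
        by (rule sep[OF that])
    qed
    finally have "\<delta> < k * r" using r by (intro power_less_imp_less_base[of \<delta> k]) auto
    then have \<rho>: "\<rho> > 0" "4 * \<rho> \<le> r" using \<delta> k by (auto simp: \<rho>_def field_simps)
    have "\<delta> ^ k * \<rho> ^ card (- I) * (\<Prod>i\<in>I. \<beta> i) \<le> (2 * k) ^ k * V"
      unfolding k_def
    proof (rule product_upper_bound[OF \<delta> \<rho> I])
      show "v = 0" if "v \<in> \<Lambda>" "v \<in> W" "\<And>i. i \<in> I \<Longrightarrow> \<bar>\<phi> v $ i\<bar> < \<delta>" for v
        by (rule sep[OF that])
      show "emeasure lborel S \<le> ennreal V"
        if "S \<in> sets borel" "\<And>x y. x \<in> S \<Longrightarrow> y \<in> S \<Longrightarrow> \<psi> (x - y) \<in> \<Lambda> \<Longrightarrow> x = y" for S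
        by (rule V[OF that])
    qed (simp add: V_def)
    moreover have "\<delta> ^ k * \<rho> ^ card (- I) > 0" using \<delta> \<rho> by simp
    ultimately show ?thesis unfolding C_def by (intro max.coboundedI2) (simp add: field_simps)
  qed (simp add: C_def)
  show ?thesis
  proof (intro exI[of _ C] allI impI, elim conjE)
    fix \<beta> :: "'n \<Rightarrow> real" and r :: real
    assume "\<forall>i. \<beta> i > 0" "(\<Prod>i\<in>UNIV. \<beta> i) = 1" "r > 0"
      "span {v\<in>\<Lambda>. \<forall>i. \<beta> i * \<bar>v $ i\<bar> \<le> r / 2} = W"
    then show "(\<Prod>i\<in>I. \<beta> i) \<le> C" by (intro bound[of \<beta> r]) (erule spec)
  qed
qed

subsection \<open>The flow\<close>

lemma flow_component:
  "(diag_flow m \<omega> t *v x) $ i = exp (flow_weight m \<omega> i * t) * x $ i"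
  by (simp add: diag_flow_def flow_weight_def matrix_vector_mult_def if_distrib[where f = "\<lambda>x. x * _"] cong: if_cong)

lemma flow_inverse: "diag_flow m \<omega> (- t) ** diag_flow m \<omega> t = mat 1"
  by (simp add: matrix_eq vec_eq_iff flow_component flip: matrix_vector_mul_assoc exp_add mult.assoc)

lemma sum_flow_weight:
  assumes "weight_vector m n \<omega>"
  shows "(\<Sum>i\<in>UNIV. flow_weight m \<omega> i) = 0"
proof -
  have "(\<Sum>i\<in>UNIV. flow_weight m \<omega> i) = (\<Sum>i | idx i \<le> m. \<omega> $ i) + (\<Sum>i | \<not> idx i \<le> m. - \<omega> $ i)"
    unfolding flow_weight_def by (subst sum.If_cases) (auto simp: Compl_eq)
  then show ?thesis
    using assms by (simp add: weight_vector_def sum_negf not_le)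
qed

text \<open>Vectors are measured at time t but kept as elements of \<Lambda>, so that spans at
  different times can be compared.\<close>

definition short_vectors ::
  "('d::{finite,linorder} rvec) set \<Rightarrow> ('d \<Rightarrow> real) \<Rightarrow> real \<Rightarrow> real \<Rightarrow> 'd rvec set" where
  "short_vectors \<Lambda> a t r = {v\<in>\<Lambda>. \<forall>i. exp (a i * t) * \<bar>v $ i\<bar> \<le> r / 2}"

lemma short_vectors_mono: "r \<le> r' \<Longrightarrow> short_vectors \<Lambda> a t r \<subseteq> short_vectors \<Lambda> a t r'"
  unfolding short_vectors_def by (safe, rule order_trans, erule spec, simp)

lemma succ_min_flow:
  fixes \<Lambda> :: "'d::{finite,linorder} rvec set" and m i :: nat and \<omega> :: "'d rvec" and t :: real
  assumes "lattice_basis \<Lambda> B B'" and i: "1 \<le> i" "i \<le> CARD('d)"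
  defines "r \<equiv> succ_min i ((\<lambda>x. diag_flow m \<omega> t *v x) ` \<Lambda>)"
  shows "r > 0"
    and "\<exists>S\<subseteq>short_vectors \<Lambda> (flow_weight m \<omega>) t r. independent S \<and> card S = i"
    and "\<rho> > 0 \<Longrightarrow> S \<subseteq> short_vectors \<Lambda> (flow_weight m \<omega>) t \<rho> \<Longrightarrow> independent S \<Longrightarrow> card S = i \<Longrightarrow> r \<le> \<rho>"
proof -
  let ?A = "diag_flow m \<omega> t" and ?A' = "diag_flow m \<omega> (- t)"
  have inv: "?A' ** ?A = mat 1" "?A ** ?A' = mat 1"
    using flow_inverse[of m \<omega> t] flow_inverse[of m \<omega> "- t"] by simp_all
  interpret image: lattice_basis "(*v) ?A ` \<Lambda>" "?A ** B" "B' ** ?A'"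
    using lattice_basis_image[OF assms(1) inv] .
  have inj: "inj ((*v) ?A)" "inj ((*v) ?A')"
    using inv matrix_left_invertible_injective by blast+
  have indep: "independent ((*v) M ` S)" "card ((*v) M ` S) = card S"
    if "inj ((*v) M)" "independent S" for M :: "'d rmat" and S
  proof -
    show "independent ((*v) M ` S)"
      by (rule linear_independent_injective_image[OF matrix_vector_mul_linear that(2) inj_on_subset[OF that(1)]]) simp
    show "card ((*v) M ` S) = card S"
      by (rule card_image[OF inj_on_subset[OF that(1)]]) simp
  qed
  note sm = image.succ_min_works[OF i, folded r_def]
  show "r > 0" by (rule sm(1))
  obtain S0 where S0: "S0 \<subseteq> (*v) ?A ` \<Lambda>" "independent S0" "card S0 = i"
    "\<And>v l. v \<in> S0 \<Longrightarrow> \<bar>v $ l\<bar> \<le> r / 2"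
    using sm(2) by blast
  have "(*v) ?A' ` S0 \<subseteq> short_vectors \<Lambda> (flow_weight m \<omega>) t r"
  proof
    fix v assume "v \<in> (*v) ?A' ` S0"
    then obtain w where w: "w \<in> S0" "v = ?A' *v w" by blast
    then obtain u where u: "u \<in> \<Lambda>" "w = ?A *v u" using S0(1) by blast
    then have "v = u" using w by (simp add: matrix_vector_mul_assoc inv)
    then show "v \<in> short_vectors \<Lambda> (flow_weight m \<omega>) t r"
      using u S0(4)[OF w(1)] by (simp add: short_vectors_def flow_component abs_mult)
  qed
  then show "\<exists>S\<subseteq>short_vectors \<Lambda> (flow_weight m \<omega>) t r. independent S \<and> card S = i"
    using indep[OF inj(2) S0(2)] S0(3) by blast
  assume \<rho>: "\<rho> > 0" and S: "S \<subseteq> short_vectors \<Lambda> (flow_weight m \<omega>) t \<rho>" "independent S" "card S = i"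
  show "r \<le> \<rho>"
  proof (rule sm(3)[OF \<rho>])
    show "(*v) ?A ` S \<subseteq> (*v) ?A ` \<Lambda>" using S(1) by (auto simp: short_vectors_def)
    show "independent ((*v) ?A ` S)" "card ((*v) ?A ` S) = i"
      using indep[OF inj(1) S(2)] S(3) by auto
    show "\<bar>v $ l\<bar> \<le> \<rho> / 2" if "v \<in> (*v) ?A ` S" for v l
      using that S(1) by (auto simp: short_vectors_def flow_component abs_mult)
  qed
qed

text \<open>The exponents grow or decay at rates of at most \<open>M\<close>, a crude common bound;
  all that matters later is that the factor tends to 1 as \<open>u\<close> tends to
  \<open>t\<close>.\<close>

lemma short_vectors_change_time:
  fixes a :: "'d::{finite,linorder} \<Rightarrow> real"
  defines "M \<equiv> \<Sum>i\<in>UNIV. \<bar>a i\<bar>"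
  shows "short_vectors \<Lambda> a t r \<subseteq> short_vectors \<Lambda> a u (exp (M * \<bar>t - u\<bar>) * r)"
proof
  fix v assume v: "v \<in> short_vectors \<Lambda> a t r"
  have "exp (a i * u) * \<bar>v $ i\<bar> \<le> exp (M * \<bar>t - u\<bar>) * r / 2" for i
  proof -
    have "\<bar>a i\<bar> \<le> M" unfolding M_def by (rule member_le_sum) auto
    then have "\<bar>a i\<bar> * \<bar>u - t\<bar> \<le> M * \<bar>t - u\<bar>"
      by (simp add: abs_minus_commute mult_right_mono)
    then have "a i * (u - t) \<le> M * \<bar>t - u\<bar>"
      unfolding abs_mult[symmetric] by linarith
    then have "a i * u \<le> M * \<bar>t - u\<bar> + a i * t" by (simp add: algebra_simps)
    then have "exp (a i * u) * \<bar>v $ i\<bar> \<le> exp (M * \<bar>t - u\<bar> + a i * t) * \<bar>v $ i\<bar>"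
      by (intro mult_right_mono) auto
    also have "\<dots> = exp (M * \<bar>t - u\<bar>) * (exp (a i * t) * \<bar>v $ i\<bar>)" by (simp add: exp_add)
    also have "\<dots> \<le> exp (M * \<bar>t - u\<bar>) * (r / 2)"
      using v by (intro mult_left_mono) (auto simp: short_vectors_def)
    finally show ?thesis by simp
  qed
  then show "v \<in> short_vectors \<Lambda> a u (exp (M * \<bar>t - u\<bar>) * r)"
    using v by (simp add: short_vectors_def)
qed

text \<open>At a fixed time every level from \<open>r t\<close> up to, but excluding,
  \<open>s t\<close> gives a span of dimension \<open>k\<close>. For \<open>u\<close> near
  \<open>t\<close> the short vectors of both times lie among those of time \<open>t\<close> at a
  level slightly above \<open>r t\<close>, so both spans equal that one. A locally constant map on
  the connected ray is constant.\<close>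

lemma gap_span_constant:
  fixes a :: "'d::{finite,linorder} \<Rightarrow> real" and r s :: "real \<Rightarrow> real"
  assumes gap: "\<And>t. t \<ge> T \<Longrightarrow> 0 < r t \<and> r t < s t"
    and ex: "\<And>t. t \<ge> T \<Longrightarrow> \<exists>S\<subseteq>short_vectors \<Lambda> a t (r t). independent S \<and> card S = k"
    and r_min: "\<And>t \<rho> S. t \<ge> T \<Longrightarrow> \<rho> > 0 \<Longrightarrow> S \<subseteq> short_vectors \<Lambda> a t \<rho> \<Longrightarrow> independent S \<Longrightarrow> card S = k \<Longrightarrow> r t \<le> \<rho>"
    and s_min: "\<And>t \<rho> S. t \<ge> T \<Longrightarrow> \<rho> > 0 \<Longrightarrow> S \<subseteq> short_vectors \<Lambda> a t \<rho> \<Longrightarrow> independent S \<Longrightarrow> card S = Suc k \<Longrightarrow> s t \<le> \<rho>"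
    and t: "t \<ge> T"
  shows "dim (span (short_vectors \<Lambda> a t (r t))) = k"
    and "span (short_vectors \<Lambda> a t (r t)) = span (short_vectors \<Lambda> a T (r T))"
proof -
  let ?W = "\<lambda>t. span (short_vectors \<Lambda> a t (r t))"
  have dim: "dim (span (short_vectors \<Lambda> a t \<rho>)) = k" if t: "t \<ge> T" and \<rho>: "r t \<le> \<rho>" "\<rho> < s t" for t \<rho>
  proof -
    obtain S where S: "S \<subseteq> short_vectors \<Lambda> a t (r t)" "independent S" "card S = k"
      using ex[OF t] by blast
    then have "S \<subseteq> short_vectors \<Lambda> a t \<rho>" using short_vectors_mono[OF \<rho>(1)] by blast
    then have "card S \<le> dim (short_vectors \<Lambda> a t \<rho>)"
      using S(2) by (rule independent_card_le_dim)
    then have "k \<le> dim (short_vectors \<Lambda> a t \<rho>)"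
      using S(3) by simp
    moreover have "\<not> Suc k \<le> dim (short_vectors \<Lambda> a t \<rho>)"
    proof
      assume le: "Suc k \<le> dim (short_vectors \<Lambda> a t \<rho>)"
      obtain A where A: "A \<subseteq> short_vectors \<Lambda> a t \<rho>" "independent A"
        "short_vectors \<Lambda> a t \<rho> \<subseteq> span A" "card A = dim (short_vectors \<Lambda> a t \<rho>)"
        by (rule basis_exists)
      have "Suc k \<le> card A" using le A(4) by simp
      then obtain A' where A': "A' \<subseteq> A" "card A' = Suc k" "finite A'"
        by (rule obtain_subset_with_card_n)
      have "s t \<le> \<rho>"
        using A(1) A'(1,2) \<rho> gap[OF t] independent_mono[OF A(2) A'(1)]
        by (intro s_min[OF t, of \<rho> A']) auto
      then show False using \<rho> by simp
    qed
    ultimately show ?thesis by (simp add: dim_span)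
  qed
  show "dim (?W t) = k" using dim t gap by auto
  define M where "M = (\<Sum>i\<in>UNIV. \<bar>a i\<bar>)"
  define E where "E t u = exp (M * \<bar>t - u\<bar>)" for t u
  have close: "?W t = ?W u" if tu: "t \<ge> T" "u \<ge> T" "E t u * (E t u * r t) < s t" for t u
  proof -
    have E: "E t u \<ge> 1" unfolding E_def M_def by (simp add: sum_nonneg)
    have sub: "short_vectors \<Lambda> a t r' \<subseteq> short_vectors \<Lambda> a u (E t u * r')"
      "short_vectors \<Lambda> a u r' \<subseteq> short_vectors \<Lambda> a t (E t u * r')" for r'
      using short_vectors_change_time[of \<Lambda> a t r' u] short_vectors_change_time[of \<Lambda> a u r' t]
      by (simp_all add: E_def M_def abs_minus_commute)
    obtain S where S: "S \<subseteq> short_vectors \<Lambda> a t (r t)" "independent S" "card S = k"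
      using ex[OF tu(1)] by blast
    have "r u \<le> E t u * r t"
      using S sub(1) gap[OF tu(1)] E by (intro r_min[OF tu(2), of _ S]) auto
    then have ru: "E t u * r u \<le> E t u * (E t u * r t)" using E by (intro mult_left_mono) auto
    \<comment> \<open>One factor compares \<open>r u\<close> with \<open>r t\<close>; the other
      carries the short vectors of time \<open>u\<close> back to time \<open>t\<close>.\<close>
    let ?\<rho> = "E t u * (E t u * r t)"
    have le: "r t \<le> ?\<rho>"
    proof -
      have "r t \<le> E t u * r t" using mult_right_mono[OF E, of "r t"] gap[OF tu(1)] by simp
      also have "\<dots> \<le> ?\<rho>" using mult_right_mono[OF E, of "E t u * r t"] gap[OF tu(1)] E by simp
      finally show ?thesis .
    qed
    have eq: "?W w = span (short_vectors \<Lambda> a t ?\<rho>)"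
      if "w \<ge> T" "short_vectors \<Lambda> a w (r w) \<subseteq> short_vectors \<Lambda> a t ?\<rho>" for w
      using that dim[OF tu(1) le tu(3)] dim[of w "r w"] gap[of w]
      by (intro subspace_dim_equal subspace_span span_mono) auto
    have "short_vectors \<Lambda> a t (r t) \<subseteq> short_vectors \<Lambda> a t ?\<rho>"
      using le by (rule short_vectors_mono)
    moreover have "short_vectors \<Lambda> a u (r u) \<subseteq> short_vectors \<Lambda> a t ?\<rho>"
      using sub(2)[of "r u"] short_vectors_mono[OF ru] by (rule order_trans)
    ultimately show ?thesis using eq[OF tu(1)] eq[OF tu(2)] by simp
  qed
  show "?W t = ?W T"
  proof (rule connected_local_const[of "{T..}" t T ?W])
    show "\<forall>t\<in>{T..}. eventually (\<lambda>u. ?W t = ?W u) (at t within {T..})"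
    proof
      fix t assume t: "t \<in> {T..}"
      have "((\<lambda>u. E t u * (E t u * r t)) \<longlongrightarrow> E t t * (E t t * r t)) (at t within {T..})"
        unfolding E_def by (intro tendsto_intros)
      then have "eventually (\<lambda>u. E t u * (E t u * r t) < s t) (at t within {T..})"
        using gap[of t] t by (intro order_tendstoD(2)) (auto simp: E_def)
      moreover have "eventually (\<lambda>u. u \<in> {T..}) (at t within {T..})"
        by (simp add: eventually_at_filter)
      ultimately show "eventually (\<lambda>u. ?W t = ?W u) (at t within {T..})"
        by eventually_elim (use close t in auto)
    qed
  qed (use t in auto)
qed

theorem theorem1p6:
  fixes \<omega> :: "'d::{finite,linorder} rvec" and \<Lambda> :: "'d rvec set" and m n k :: nat
  assumes "CARD('d) \<ge> 2" and "m \<ge> 1" and "n \<ge> 1" and "m + n = CARD('d)"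
    and "weight_vector m n \<omega>"
    and "k \<in> {1..CARD('d) - 1}"
    and "unimodular_lattice \<Lambda>"
    and "\<And>W. subspace W \<Longrightarrow> dim W = k \<Longrightarrow> \<exists>S\<subseteq>\<Lambda>. span S = W \<Longrightarrow>
           largest_eigenvalue k (diag_flow m \<omega> 1) (subspace_vector W) > 1"
  shows "connected_at m \<omega> \<Lambda> k"
proof (rule ccontr)
  assume "\<not> connected_at m \<omega> \<Lambda> k"
  then obtain b where b: "\<And>t. t \<ge> 0 \<Longrightarrow> log_min m \<omega> \<Lambda> k t = log_min m \<omega> \<Lambda> (k + 1) t \<Longrightarrow> t \<le> b"
    unfolding connected_at_def bdd_above_def by auto
  \<comment> \<open>From \<open>T\<close> on, times are nonnegative and exceed \<open>b\<close>, so
    the two logarithms, and hence the two minima, differ.\<close>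
  define T where "T = max 0 b + 1"
  obtain B B' where B: "lattice_basis \<Lambda> B B'"
    using unimodular_lattice_basis[OF assms(7)] .
  define a where "a = flow_weight m \<omega>"
  define r where "r i t = succ_min i ((\<lambda>x. diag_flow m \<omega> t *v x) ` \<Lambda>)" for i t
  have k: "1 \<le> k" "k \<le> CARD('d)" "1 \<le> Suc k" "Suc k \<le> CARD('d)"
    using assms(1,6) by auto
  note rk = succ_min_flow[OF B k(1,2), where m = m and \<omega> = \<omega>, folded r_def a_def]
  note rk1 = succ_min_flow[OF B k(3,4), where m = m and \<omega> = \<omega>, folded r_def a_def]
  have gap: "0 < r k t \<and> r k t < r (Suc k) t" if t: "t \<ge> T" for t
  proof -
    obtain S where S: "S \<subseteq> short_vectors \<Lambda> a t (r (Suc k) t)" "independent S" "card S = Suc k"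
      using rk1(2) by blast
    then have "k \<le> card S" by simp
    then obtain S' where S': "S' \<subseteq> S" "card S' = k" "finite S'"
      by (rule obtain_subset_with_card_n)
    have "r k t \<le> r (Suc k) t"
      using S'(1) S(1) by (intro rk(3)[OF rk1(1) _ independent_mono[OF S(2) S'(1)] S'(2)]) (rule order_trans)
    moreover have "0 \<le> t" "b < t" using t unfolding T_def by linarith+
    then have "r k t \<noteq> r (Suc k) t"
      using b[of t] by (auto simp: log_min_def r_def)
    ultimately show ?thesis using rk(1)[of t] by simp
  qed
  define W where "W = span (short_vectors \<Lambda> a T (r k T))"
  have spn: "dim (span (short_vectors \<Lambda> a t (r k t))) = k" "span (short_vectors \<Lambda> a t (r k t)) = W"
    if "t \<ge> T" for t
  proof -
    show "dim (span (short_vectors \<Lambda> a t (r k t))) = k"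
      by (rule gap_span_constant(1)[where T = T and s = "r (Suc k)"])
         (rule gap rk(2) that rk(3) rk1(3); assumption)+
    show "span (short_vectors \<Lambda> a t (r k t)) = W"
      unfolding W_def by (rule gap_span_constant(2)[where s = "r (Suc k)" and k = k])
         (rule gap rk(2) that rk(3) rk1(3); assumption)+
  qed
  have subW: "subspace W" and dimW: "dim W = k"
    using spn(1)[of T] by (simp_all add: W_def)
  \<comment> \<open>This makes \<open>W\<close> a span of lattice vectors, as the eigenvalue
    hypothesis demands.\<close>
  have "short_vectors \<Lambda> a T (r k T) \<subseteq> \<Lambda>" by (auto simp: short_vectors_def)
  then have "largest_eigenvalue k (diag_flow m \<omega> 1) (subspace_vector W) > 1"
    using subW dimW by (intro assms(8)) (auto simp: W_def)
  then obtain I where I: "card I = k" "(\<Sum>i\<in>I. flow_weight m \<omega> i) > 0"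
    "\<forall>x\<in>W. (\<forall>i\<in>I. x $ i = 0) \<longrightarrow> x = 0"
    by (rule expanding_coordinates[OF subW dimW])
  have dimI: "dim W = card I" using dimW I(1) by simp
  have "\<exists>\<phi> \<psi>. adapted_coordinates \<Lambda> B B' W I \<phi> \<psi>"
  proof (rule transversal_coordinates[OF subW dimI])
    fix \<phi> \<psi> :: "'d rvec \<Rightarrow> 'd rvec"
    assume coords: "linear \<phi>" "linear \<psi>" "\<And>x. \<psi> (\<phi> x) = x" "\<And>y. \<phi> (\<psi> y) = y"
      "\<And>x i. i \<in> I \<Longrightarrow> \<phi> x $ i = x $ i" "\<And>x. x \<in> W \<longleftrightarrow> (\<forall>j. j \<notin> I \<longrightarrow> \<phi> x $ j = 0)"
      "\<And>j. j \<notin> I \<Longrightarrow> \<phi> (axis j 1) = axis j 1"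
    have "adapted_coordinates \<Lambda> B B' W I \<phi> \<psi>"
      by (intro adapted_coordinates.intro adapted_coordinates_axioms.intro) (rule B coords | assumption)+
    then show ?thesis by (intro exI)
  qed (use I(3) in blast)
  then obtain \<phi> \<psi> where "adapted_coordinates \<Lambda> B B' W I \<phi> \<psi>" by (elim exE)
  then interpret adapted_coordinates \<Lambda> B B' W I \<phi> \<psi> .
  obtain C where C: "\<forall>\<beta> r. (\<forall>i. \<beta> i > 0) \<and> (\<Prod>i\<in>UNIV. \<beta> i) = 1 \<and> r > 0 \<and>
    span {v\<in>\<Lambda>. \<forall>i. \<beta> i * \<bar>v $ i\<bar> \<le> r / 2} = W \<longrightarrow> (\<Prod>i\<in>I. \<beta> i) \<le> C"
    using product_bounded[OF dimI] by (elim exE)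
  let ?\<epsilon> = "\<Sum>i\<in>I. a i"
  have bound: "exp (?\<epsilon> * t) \<le> C" if t: "t \<ge> T" for t
  proof -
    have "(\<Prod>i\<in>I. exp (a i * t)) \<le> C"
    proof (rule C[rule_format], intro conjI)
      have "(\<Prod>i\<in>UNIV. exp (a i * t)) = exp ((\<Sum>i\<in>UNIV. a i) * t)"
        by (simp add: exp_sum sum_distrib_right)
      then show "(\<Prod>i\<in>UNIV. exp (a i * t)) = 1"
        using sum_flow_weight[OF assms(5)] by (simp add: a_def)
      show "r k t > 0" using gap[OF t] by simp
      show "span {v\<in>\<Lambda>. \<forall>i. exp (a i * t) * \<bar>v $ i\<bar> \<le> r k t / 2} = W"
        using spn(2)[OF t] by (simp add: short_vectors_def)
      show "\<forall>i. exp (a i * t) > 0" by simp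
    qed
    then show ?thesis by (simp add: exp_sum sum_distrib_right)
  qed
  \<comment> \<open>From \<open>C / ?\<epsilon>\<close> on, the bound 1 + x for the exponential
    already exceeds \<open>C\<close>.\<close>
  define t where "t = max T (C / ?\<epsilon>)"
  have "C \<le> ?\<epsilon> * t" using I(2) by (simp add: t_def a_def field_simps max_def)
  also have "\<dots> < exp (?\<epsilon> * t)" using exp_ge_add_one_self[of "?\<epsilon> * t"] by linarith
  also have "\<dots> \<le> C" by (rule bound) (simp add: t_def)
  finally show False by simp
qed

end
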